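(* For a skew monoidal monoid $\mathcal A=\langle A,T,Q,\gamma,\eta,\varepsilon\rangle$ the following conditions are equivalent: (i) $G$, the right $A$-bialgebroid associated to $\mathcal A$, is left Hopf, i.e., the opmonoidal monad $\hat T=-\otimes_EG$ on ${}_A\mathbf{Set}_A$ is a left Hopf monad. (ii) The canonical map $$\mathrm{can}^G:G\otimes_{T(A)}G\to G\otimes_AG,\qquad g\otimes_{T(A)}h\mapsto h^{(1)}\otimes_Agh^{(2)}$$ is a bijection. (iii) $\gamma$ is invertible. (iv) The canonical map $$\mathrm{can}_F:F\otimes_{Q(A)}F\to F\otimes_AF,\qquad f\otimes_{Q(A)}f'\mapsto f_{(1)}f'\otimes_Af_{(2)}$$ is a bijection. (v) $F$, the left $A$-bialgebroid associated to $\mathcal A$, is right Hopf, i.e., the opmonoidal monad $F\otimes_{A\times A^{\mathrm{op}}}-$ on ${}_A\mathbf{Set}_A$ is a right Hopf monad.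
   Context: A skew monoidal monoid $\mathcal A=\langle A,T,Q,\gamma,\eta,\varepsilon\rangle$ consists of a monoid $A$, monoid endomorphisms $T,Q:A\to A$ and elements $\gamma,\eta,\varepsilon\in A$ such that for all $a,b\in A$: $T(a)Q(b)=Q(b)T(a)$, $\gamma T^2(a)=T(a)\gamma$, $\gamma TQ(a)=QT(a)\gamma$, $\gamma Q(a)=Q^2(a)\gamma$, $\eta a=T(a)\eta$, $a\varepsilon=\varepsilon Q(a)$, $Q(\gamma)\gamma T(\gamma)=\gamma^2$, $\gamma\eta=Q(\eta)$, $\varepsilon\gamma=T(\varepsilon)$, $Q(\varepsilon)\gamma T(\eta)=1$, $\varepsilon\eta=1$. Put $\mu:=Q(\varepsilon)\gamma$, $\delta:=\gamma T(\eta)$ (then $\gamma=\mu\delta$) and $S:A\to A^{\mathrm{op}}$, $S(a):=\mu T(Q(a)\eta)$, a monoid morphism. $G=\mu T(A)$ is a submonoid of $A$ and a right $A$-bialgebroid with source $T$, target $S$, bimodule structure $a_1\cdot g\cdot a_2=gS(a_1)T(a_2)$ (used in $G\otimes_AG$), comultiplication $\Delta^G(g)=g^{(1)}\otimes g^{(2)}=\mu\otimes_A\mu T(\delta g\eta)$, counit $g\mapsto\varepsilon g\eta$. $F=Q(A)\delta$ is a submonoid of $A$ and a left $A$-bialgebroid with source $Q$, target $S$, bimodule structure $a_1\cdot f\cdot a_2=Q(a_1)S(a_2)f$ (used in $F\otimes_AF$), comultiplication $\Delta_F(f)=f_{(1)}\otimes f_{(2)}=Q(\varepsilon f\mu)\delta\otimes_A\delta$,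 counit $f\mapsto\varepsilon f\eta$. $G\otimes_{T(A)}G$ is the quotient of $G\times G$ by $(gT(a),h)\sim(g,T(a)h)$, and $F\otimes_{Q(A)}F$ that of $F\times F$ by $(fQ(a),f')\sim(f,Q(a)f')$. ${}_A\mathbf{Set}_A$ is the monoidal category of $A$-$A$-bisets (bimodules). With $E:=A^{\mathrm{op}}\times A$ it is identified with right $E$-sets, and $\hat TX:=X\otimes_EG$, the quotient of $X\times G$ by $(a_1\cdot x\cdot a_2,g)\sim(x,S(a_1)T(a_2)g)$, with bimodule structure $a_1\cdot(x\otimes g)\cdot a_2=x\otimes gS(a_1)T(a_2)$, monad multiplication $\hat\mu_X:(x\otimes g)\otimes h\mapsto x\otimes gh$ and unit $x\mapsto x\otimes1_G$, and opmonoidal structure $\hat T_{X,Y}:(x\otimes_Ay)\otimes g\mapsto(x\otimes g^{(1)})\otimes_A(y\otimes g^{(2)})$, $A\otimes_EG\to A$, $a\otimes g\mapsto\varepsilon T(a)g\eta$. An opmonoidal monad $\hat T$ is a left Hopf monad if all left fusion morphisms $H^\ell_{X,Y}=(\hat TX\otimes_A\hat\mu_Y)\circ\hat T_{X,\hat TY}:\hat T(X\otimes_A\hat TY)\to\hat TX\otimes_A\hat TY$ are invertible, and a right Hopf monad if all right fusion morphisms $H^r_{X,Y}=(\hat\mu_X\otimes_A\hat TY)\circ\hat T_{\hat TX,Y}:\hat T(\hat TX\otimes_AY)\to\hat TX\otimes_A\hat TY$ are invertible. Analogously $F\otimes_{A\times A^{\mathrm{op}}}X$ is the quotient of $F\times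 X$ by $(fQ(a_1)S(a_2),x)\sim(f,a_1\cdot x\cdot a_2)$, with bimodule structure $a_1\cdot(f\otimes x)\cdot a_2=Q(a_1)S(a_2)f\otimes x$, multiplication $f\otimes(f'\otimes x)\mapsto ff'\otimes x$, unit $x\mapsto1_F\otimes x$, and opmonoidal structure $f\otimes(x\otimes_Ay)\mapsto(f_{(1)}\otimes x)\otimes_A(f_{(2)}\otimes y)$, $f\otimes a\mapsto\varepsilon fQ(a)\eta$. *)

theory Defs
  imports Main
begin

section \<open>Tensor products of sets\<close>

text \<open>
  For a right action \<open>r\<close> on \<open>X\<close> and a left action \<open>l\<close> on \<open>Y\<close> of the same type of scalars, the
  tensor product is the quotient of \<open>X \<times> Y\<close> by the equivalence relation generated by
  \<open>(r x s, y) \<sim> (x, l s y)\<close>.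
\<close>

definition balance ::
  "'x set \<Rightarrow> 'y set \<Rightarrow> ('x \<Rightarrow> 's \<Rightarrow> 'x) \<Rightarrow> ('s \<Rightarrow> 'y \<Rightarrow> 'y) \<Rightarrow> (('x \<times> 'y) \<times> ('x \<times> 'y)) set" where
  "balance X Y r l = {(p, q). p \<in> X \<times> Y \<and> q \<in> X \<times> Y \<and>
     equivclp (\<lambda>p q. \<exists>x\<in>X. \<exists>y\<in>Y. \<exists>s. p = (r x s, y) \<and> q = (x, l s y)) p q}"

definition tens_set ::
  "'x set \<Rightarrow> 'y set \<Rightarrow> ('x \<Rightarrow> 's \<Rightarrow> 'x) \<Rightarrow> ('s \<Rightarrow> 'y \<Rightarrow> 'y) \<Rightarrow> ('x \<times> 'y) set set" where
  "tens_set X Y r l = (X \<times> Y) // balance X Y r l"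

definition tens ::
  "'x set \<Rightarrow> 'y set \<Rightarrow> ('x \<Rightarrow> 's \<Rightarrow> 'x) \<Rightarrow> ('s \<Rightarrow> 'y \<Rightarrow> 'y) \<Rightarrow> 'x \<Rightarrow> 'y \<Rightarrow> ('x \<times> 'y) set" where
  "tens X Y r l x y = balance X Y r l `` {(x, y)}"

text \<open>
  The map \<open>x \<otimes> y \<mapsto> f x y\<close> on equivalence classes. It is unspecified on a class on which \<open>f\<close> is
  not constant.
\<close>

definition lift_tens :: "('x \<Rightarrow> 'y \<Rightarrow> 'z) \<Rightarrow> ('x \<times> 'y) set \<Rightarrow> 'z" where
  "lift_tens f c = the_elem ((\<lambda>(x, y). f x y) ` c)"


section \<open>The monoidal category of bisets\<close>

record ('a, 'x) biset =
  carr :: "'x set"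
  lact :: "'a \<Rightarrow> 'x \<Rightarrow> 'x"
  ract :: "'x \<Rightarrow> 'a \<Rightarrow> 'x"

definition is_biset :: "('a::monoid_mult, 'x) biset \<Rightarrow> bool" where
  "is_biset X \<longleftrightarrow> (\<forall>x\<in>carr X.
     (\<forall>a. lact X a x \<in> carr X \<and> ract X x a \<in> carr X) \<and>
     lact X 1 x = x \<and> ract X x 1 = x \<and>
     (\<forall>a b. lact X (a * b) x = lact X a (lact X b x)) \<and>
     (\<forall>a b. ract X x (a * b) = ract X (ract X x a) b) \<and>
     (\<forall>a b. ract X (lact X a x) b = lact X a (ract X x b)))"

definition biset_hom ::
  "('a::monoid_mult, 'x) biset \<Rightarrow> ('a, 'y) biset \<Rightarrow> ('x \<Rightarrow> 'y) \<Rightarrow> bool" where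
  "biset_hom X Y f \<longleftrightarrow> (\<forall>x\<in>carr X. f x \<in> carr Y \<and>
     (\<forall>a. f (lact X a x) = lact Y a (f x)) \<and> (\<forall>a. f (ract X x a) = ract Y (f x) a))"

definition biset_iso ::
  "('a::monoid_mult, 'x) biset \<Rightarrow> ('a, 'y) biset \<Rightarrow> ('x \<Rightarrow> 'y) \<Rightarrow> bool" where
  "biset_iso X Y f \<longleftrightarrow> biset_hom X Y f \<and>
     (\<exists>g. biset_hom Y X g \<and> (\<forall>x\<in>carr X. g (f x) = x) \<and> (\<forall>y\<in>carr Y. f (g y) = y))"

definition tensA :: "('a, 'x) biset \<Rightarrow> ('a, 'y) biset \<Rightarrow> 'x \<Rightarrow> 'y \<Rightarrow> ('x \<times> 'y) set" where
  "tensA X Y = tens (carr X) (carr Y) (ract X) (lact Y)"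

definition tensorA ::
  "('a, 'x) biset \<Rightarrow> ('a, 'y) biset \<Rightarrow> ('a, ('x \<times> 'y) set) biset" where
  "tensorA X Y =
     \<lparr> carr = tens_set (carr X) (carr Y) (ract X) (lact Y),
       lact = (\<lambda>a. lift_tens (\<lambda>x y. tensA X Y (lact X a x) y)),
       ract = (\<lambda>c a. lift_tens (\<lambda>x y. tensA X Y x (ract Y y a)) c) \<rparr>"

text \<open>
  The tensor product of morphisms \<open>f\<close> and \<open>g\<close> with targets \<open>X\<close> and \<open>Y\<close>; the sources do not enter
  the formula.
\<close>

definition tensor_map ::
  "('a, 'x) biset \<Rightarrow> ('a, 'y) biset \<Rightarrow> ('w \<Rightarrow> 'x) \<Rightarrow> ('z \<Rightarrow> 'y) \<Rightarrow> ('w \<times> 'z) set \<Rightarrow> ('x \<times> 'y) set" where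
  "tensor_map X Y f g = lift_tens (\<lambda>w z. tensA X Y (f w) (g z))"


section \<open>Skew monoidal monoids\<close>

locale skew_monoidal_monoid =
  fixes T Q :: "'a::monoid_mult \<Rightarrow> 'a" and \<gamma> \<eta> \<epsilon> :: 'a
  assumes T_one: "T 1 = 1" and T_mult: "T (a * b) = T a * T b"
    and Q_one: "Q 1 = 1" and Q_mult: "Q (a * b) = Q a * Q b"
    and TQ_comm: "T a * Q b = Q b * T a"
    and gamma_TT: "\<gamma> * T (T a) = T a * \<gamma>"
    and gamma_TQ: "\<gamma> * T (Q a) = Q (T a) * \<gamma>"
    and gamma_Q: "\<gamma> * Q a = Q (Q a) * \<gamma>"
    and eta_T: "\<eta> * a = T a * \<eta>"
    and eps_Q: "a * \<epsilon> = \<epsilon> * Q a"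
    and pentagon: "Q \<gamma> * \<gamma> * T \<gamma> = \<gamma> ^ 2"
    and gamma_eta: "\<gamma> * \<eta> = Q \<eta>"
    and eps_gamma: "\<epsilon> * \<gamma> = T \<epsilon>"
    and Qeps_gamma_Teta: "Q \<epsilon> * \<gamma> * T \<eta> = 1"
    and eps_eta: "\<epsilon> * \<eta> = 1"
begin

definition \<mu> :: 'a where "\<mu> = Q \<epsilon> * \<gamma>"

definition \<delta> :: 'a where "\<delta> = \<gamma> * T \<eta>"

definition S :: "'a \<Rightarrow> 'a" where "S a = \<mu> * T (Q a * \<eta>)"


subsection \<open>The right bialgebroid \<open>G\<close>\<close>

definition G :: "'a set" where "G = range (\<lambda>a. \<mu> * T a)"

definition G_biset :: "('a, 'a) biset" where
  "G_biset = \<lparr> carr = G, lact = (\<lambda>a g. g * S a), ract = (\<lambda>g a. g * T a) \<rparr>"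

definition comult_G :: "'a \<Rightarrow> ('a \<times> 'a) set" where
  "comult_G g = tensA G_biset G_biset \<mu> (\<mu> * T (\<delta> * g * \<eta>))"

definition G_tensor_T_G :: "('a \<times> 'a) set set" where
  "G_tensor_T_G = tens_set G G (\<lambda>g a. g * T a) (\<lambda>a h. T a * h)"

definition can_G :: "('a \<times> 'a) set \<Rightarrow> ('a \<times> 'a) set" where
  "can_G = lift_tens (\<lambda>g h. lift_tens (\<lambda>h1 h2. tensA G_biset G_biset h1 (g * h2)) (comult_G h))"

text \<open>
  The opmonoidal monad \<open>- \<otimes>\<^sub>E G\<close>, where a biset is a right \<open>E\<close>-set through
  \<open>x \<cdot> (a1, a2) = a1 \<cdot> x \<cdot> a2\<close>.
\<close>

definition tensE_G :: "('a, 'x) biset \<Rightarrow> 'x \<Rightarrow> 'a \<Rightarrow> ('x \<times> 'a) set" where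
  "tensE_G X = tens (carr X) G
     (\<lambda>x (a1, a2). ract X (lact X a1 x) a2) (\<lambda>(a1, a2) g. S a1 * T a2 * g)"

definition That :: "('a, 'x) biset \<Rightarrow> ('a, ('x \<times> 'a) set) biset" where
  "That X =
     \<lparr> carr = tens_set (carr X) G
         (\<lambda>x (a1, a2). ract X (lact X a1 x) a2) (\<lambda>(a1, a2) g. S a1 * T a2 * g),
       lact = (\<lambda>a. lift_tens (\<lambda>x g. tensE_G X x (g * S a))),
       ract = (\<lambda>c a. lift_tens (\<lambda>x g. tensE_G X x (g * T a)) c) \<rparr>"

definition That_mult :: "('a, 'x) biset \<Rightarrow> (('x \<times> 'a) set \<times> 'a) set \<Rightarrow> ('x \<times> 'a) set" where
  "That_mult X = lift_tens (\<lambda>c h. lift_tens (\<lambda>x g. tensE_G X x (g * h)) c)"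

definition That_opmon :: "('a, 'x) biset \<Rightarrow> ('a, 'y) biset \<Rightarrow>
    (('x \<times> 'y) set \<times> 'a) set \<Rightarrow> (('x \<times> 'a) set \<times> ('y \<times> 'a) set) set" where
  "That_opmon X Y = lift_tens (\<lambda>c g. lift_tens (\<lambda>x y.
     lift_tens (\<lambda>g1 g2. tensA (That X) (That Y) (tensE_G X x g1) (tensE_G Y y g2))
       (comult_G g)) c)"

definition left_fusion_G :: "('a, 'x) biset \<Rightarrow> ('a, 'y) biset \<Rightarrow>
    (('x \<times> ('y \<times> 'a) set) set \<times> 'a) set \<Rightarrow> (('x \<times> 'a) set \<times> ('y \<times> 'a) set) set" where
  "left_fusion_G X Y = tensor_map (That X) (That Y) id (That_mult Y) \<circ> That_opmon X (That Y)"

text \<open>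
  The type \<open>'u\<close> plays the role of the universe of small sets: the objects of the category of
  bisets are those whose carrier is a set of elements of \<open>'u\<close>.
\<close>

definition left_Hopf_G :: "'u itself \<Rightarrow> bool" where
  "left_Hopf_G _ \<longleftrightarrow> (\<forall>(X :: ('a, 'u) biset) (Y :: ('a, 'u) biset). is_biset X \<longrightarrow> is_biset Y \<longrightarrow>
     biset_iso (That (tensorA X (That Y))) (tensorA (That X) (That Y)) (left_fusion_G X Y))"


subsection \<open>The left bialgebroid \<open>F\<close>\<close>

definition F :: "'a set" where "F = range (\<lambda>a. Q a * \<delta>)"

definition F_biset :: "('a, 'a) biset" where
  "F_biset = \<lparr> carr = F, lact = (\<lambda>a f. Q a * f), ract = (\<lambda>f a. S a * f) \<rparr>"

definition comult_F :: "'a \<Rightarrow> ('a \<times> 'a) set" where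
  "comult_F f = tensA F_biset F_biset (Q (\<epsilon> * f * \<mu>) * \<delta>) \<delta>"

definition F_tensor_Q_F :: "('a \<times> 'a) set set" where
  "F_tensor_Q_F = tens_set F F (\<lambda>f a. f * Q a) (\<lambda>a f'. Q a * f')"

definition can_F :: "('a \<times> 'a) set \<Rightarrow> ('a \<times> 'a) set" where
  "can_F = lift_tens (\<lambda>f f'. lift_tens (\<lambda>f1 f2. tensA F_biset F_biset (f1 * f') f2) (comult_F f))"

text \<open>The opmonoidal monad \<open>F \<otimes> -\<close> over \<open>A \<times> A\<^sup>o\<^sup>p\<close>.\<close>

definition tensE_F :: "('a, 'x) biset \<Rightarrow> 'a \<Rightarrow> 'x \<Rightarrow> ('a \<times> 'x) set" where
  "tensE_F X = tens F (carr X)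
     (\<lambda>f (a1, a2). f * Q a1 * S a2) (\<lambda>(a1, a2) x. ract X (lact X a1 x) a2)"

definition Fhat :: "('a, 'x) biset \<Rightarrow> ('a, ('a \<times> 'x) set) biset" where
  "Fhat X =
     \<lparr> carr = tens_set F (carr X)
         (\<lambda>f (a1, a2). f * Q a1 * S a2) (\<lambda>(a1, a2) x. ract X (lact X a1 x) a2),
       lact = (\<lambda>a. lift_tens (\<lambda>f x. tensE_F X (Q a * f) x)),
       ract = (\<lambda>c a. lift_tens (\<lambda>f x. tensE_F X (S a * f) x) c) \<rparr>"

definition Fhat_mult :: "('a, 'x) biset \<Rightarrow> ('a \<times> ('a \<times> 'x) set) set \<Rightarrow> ('a \<times> 'x) set" where
  "Fhat_mult X = lift_tens (\<lambda>f c. lift_tens (\<lambda>f' x. tensE_F X (f * f') x) c)"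

definition Fhat_opmon :: "('a, 'x) biset \<Rightarrow> ('a, 'y) biset \<Rightarrow>
    ('a \<times> ('x \<times> 'y) set) set \<Rightarrow> (('a \<times> 'x) set \<times> ('a \<times> 'y) set) set" where
  "Fhat_opmon X Y = lift_tens (\<lambda>f c. lift_tens (\<lambda>x y.
     lift_tens (\<lambda>f1 f2. tensA (Fhat X) (Fhat Y) (tensE_F X f1 x) (tensE_F Y f2 y))
       (comult_F f)) c)"

definition right_fusion_F :: "('a, 'x) biset \<Rightarrow> ('a, 'y) biset \<Rightarrow>
    ('a \<times> (('a \<times> 'x) set \<times> 'y) set) set \<Rightarrow> (('a \<times> 'x) set \<times> ('a \<times> 'y) set) set" where
  "right_fusion_F X Y = tensor_map (Fhat X) (Fhat Y) (Fhat_mult X) id \<circ> Fhat_opmon (Fhat X) Y"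

definition right_Hopf_F :: "'u itself \<Rightarrow> bool" where
  "right_Hopf_F _ \<longleftrightarrow> (\<forall>(X :: ('a, 'u) biset) (Y :: ('a, 'u) biset). is_biset X \<longrightarrow> is_biset Y \<longrightarrow>
     biset_iso (Fhat (tensorA (Fhat X) Y)) (tensorA (Fhat X) (Fhat Y)) (right_fusion_F X Y))"

end

end

theory Submission
  imports Defs
begin

text \<open>
  Every element of \<open>G\<close> is \<open>\<mu> T(a)\<close> for a unique \<open>a\<close>, namely \<open>a = g \<eta>\<close>. In this coordinate both
  \<open>G \<otimes>\<^bsub>T(A)\<^esub> G\<close> and \<open>G \<otimes>\<^sub>A G\<close> become \<open>A\<close> and the canonical map becomes left multiplication by
  \<open>\<gamma>\<close>. The left fusion morphism sends \<open>(x \<otimes> (y \<otimes> \<mu>)) \<otimes> \<mu> T(e)\<close> to \<open>(x \<otimes> \<mu>) \<otimes> (y \<otimes> \<mu> T(\<gamma> e))\<close>,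
  so multiplying by the inverse of \<open>\<gamma>\<close> inverts it; for bisets free of rank one its source and
  target are \<open>A\<close> and it is again left multiplication by \<open>\<gamma>\<close>. The free biset \<open>A \<times> A\<close> need not embed
  into a universe containing \<open>A\<close> when \<open>A\<close> is finite, but if \<open>A\<close> is finite, \<open>\<gamma> = \<mu> \<delta>\<close> is
  invertible anyway because \<open>\<mu> \<eta> = 1 = \<epsilon> \<delta>\<close>. The statements on \<open>F = Q(A) \<delta>\<close> are the mirror images
  under reversing the multiplication and exchanging \<open>T\<close> with \<open>Q\<close> and \<open>\<eta>\<close> with \<open>\<epsilon>\<close>.
\<close>

section \<open>Tensor products\<close>

lemma equiv_balance: "equiv (X \<times> Y) (balance X Y r l)"
  unfolding balance_def
  by (intro equivI refl_onI symI transI)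
    (auto intro: equivclp_sym equivclp_trans)

lemma tens_in: "x \<in> X \<Longrightarrow> y \<in> Y \<Longrightarrow> tens X Y r l x y \<in> tens_set X Y r l"
  unfolding tens_def tens_set_def by (auto intro: quotientI)

lemma tens_setE:
  assumes "c \<in> tens_set X Y r l"
  obtains x y where "x \<in> X" "y \<in> Y" "c = tens X Y r l x y"
  using assms unfolding tens_def tens_set_def by (auto elim!: quotientE)

lemma tens_balance:
  assumes "x \<in> X" "y \<in> Y" "r x s \<in> X" "l s y \<in> Y"
  shows "tens X Y r l (r x s) y = tens X Y r l x (l s y)"
  unfolding tens_def
  by (rule equiv_class_eq[OF equiv_balance])
    (use assms in \<open>auto simp: balance_def intro!: r_into_equivclp\<close>)

text \<open>A balanced \<open>f\<close> agrees on the two ends of each generating pair, hence along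
  every zigzag of such pairs, so it is constant on a class.\<close>

lemma lift_tens_tens:
  assumes "x \<in> X" "y \<in> Y"
    and "\<And>x y s. x \<in> X \<Longrightarrow> y \<in> Y \<Longrightarrow> f (r x s) y = f x (l s y)"
  shows "lift_tens f (tens X Y r l x y) = f x y"
proof -
  let ?R = "\<lambda>p q. \<exists>x\<in>X. \<exists>y\<in>Y. \<exists>s. p = (r x s, y) \<and> q = (x, l s y)"
  have "case_prod f p = case_prod f q" if "equivclp ?R p q" for p q
    using that by (induction rule: equivclp_induct) (auto simp: assms(3))
  then have "(\<lambda>(x, y). f x y) ` tens X Y r l x y = {f x y}"
    using assms(1,2) unfolding tens_def balance_def by force
  then show ?thesis
    unfolding lift_tens_def by simp
qed

text \<open>A normal form criterion. The balanced function \<open>\<phi>\<close> recovers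
  \<open>z\<close> from its class, which gives injectivity; the last assumption brings every tensor
  into the form \<open>a z \<otimes> b z\<close>.\<close>

lemma bij_betw_tens:
  assumes "\<And>z. z \<in> Z \<Longrightarrow> a z \<in> X" "\<And>z. z \<in> Z \<Longrightarrow> b z \<in> Y"
    and "\<And>x y s. x \<in> X \<Longrightarrow> y \<in> Y \<Longrightarrow> \<phi> (r x s) y = \<phi> x (l s y)"
    and "\<And>z. z \<in> Z \<Longrightarrow> \<phi> (a z) (b z) = z"
    and "\<And>x y. x \<in> X \<Longrightarrow> y \<in> Y \<Longrightarrow> \<exists>z\<in>Z. tens X Y r l x y = tens X Y r l (a z) (b z)"
  shows "bij_betw (\<lambda>z. tens X Y r l (a z) (b z)) Z (tens_set X Y r l)"
proof (intro bij_betw_imageI inj_onI equalityI subsetI)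
  fix z z' assume z: "z \<in> Z" "z' \<in> Z" and eq: "tens X Y r l (a z) (b z) = tens X Y r l (a z') (b z')"
  have "z = lift_tens \<phi> (tens X Y r l (a z) (b z))" if "z \<in> Z" for z
    by (subst lift_tens_tens) (simp_all add: assms(1-4) that)
  with z eq show "z = z'" by metis
next
  fix c assume "c \<in> tens_set X Y r l"
  then show "c \<in> (\<lambda>z. tens X Y r l (a z) (b z)) ` Z"
    using assms(5) by (blast elim: tens_setE)
qed (auto simp: assms(1,2) intro!: tens_in)

text \<open>Applied with coordinates \<open>D\<close> and \<open>C\<close> by elements of
  \<open>A\<close>, in which \<open>h\<close> is multiplication by \<open>\<gamma>\<close>.\<close>

lemma bij_betw_conjugate:
  assumes "bij_betw D U X" "bij_betw C V Y" "\<And>e. e \<in> U \<Longrightarrow> h e \<in> V" "\<And>e. e \<in> U \<Longrightarrow> f (D e) = C (h e)"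
  shows "bij_betw f X Y \<longleftrightarrow> bij_betw h U V"
proof -
  have "bij_betw f X Y \<longleftrightarrow> bij_betw (f \<circ> D) U Y"
    using bij_betw_comp_iff[OF assms(1)] .
  also have "\<dots> \<longleftrightarrow> bij_betw (C \<circ> h) U Y"
    by (rule bij_betw_cong) (simp add: assms(4))
  also have "\<dots> \<longleftrightarrow> bij_betw h U V"
    using bij_betw_comp_iff2[OF assms(2), of h U] assms(3) by blast
  finally show ?thesis .
qed

section \<open>Bisets\<close>

lemma is_bisetD:
  assumes "is_biset X" "x \<in> carr X"
  shows "lact X a x \<in> carr X" "ract X x a \<in> carr X" "lact X 1 x = x" "ract X x 1 = x"
    "lact X (a * b) x = lact X a (lact X b x)" "ract X x (a * b) = ract X (ract X x a) b"
    "ract X (lact X a x) b = lact X a (ract X x b)"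
  using assms unfolding is_biset_def by auto

text \<open>The inverse of a bijective equivariant map is automatically equivariant. That
  \<open>X\<close> is a biset keeps the translates of preimages inside its carrier, where
  \<open>g\<close> undoes \<open>f\<close>.\<close>

lemma biset_iso_iff:
  assumes "is_biset X"
  shows "biset_iso X Y f \<longleftrightarrow> biset_hom X Y f \<and> bij_betw f (carr X) (carr Y)"
proof
  assume "biset_iso X Y f"
  then obtain g where "biset_hom X Y f" "biset_hom Y X g"
      "\<forall>x\<in>carr X. g (f x) = x" "\<forall>y\<in>carr Y. f (g y) = y"
    unfolding biset_iso_def by blast
  then show "biset_hom X Y f \<and> bij_betw f (carr X) (carr Y)"
    unfolding biset_hom_def by (auto intro!: bij_betw_byWitness[of _ g])
next
  assume f: "biset_hom X Y f \<and> bij_betw f (carr X) (carr Y)"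
  define g where "g = inv_into (carr X) f"
  have g: "g y \<in> carr X" "f (g y) = y" if "y \<in> carr Y" for y
    using f that unfolding g_def bij_betw_def by (auto intro: inv_into_into f_inv_into_f)
  have gf: "g (f x) = x" if "x \<in> carr X" for x
    using f that unfolding g_def bij_betw_def by auto
  have "g (lact Y a y) = lact X a (g y)" "g (ract Y y a) = ract X (g y) a"
    if y: "y \<in> carr Y" for a y
    using f g[OF y] gf[of "lact X a (g y)"] gf[of "ract X (g y) a"] is_bisetD(1,2)[OF assms, of "g y"]
    unfolding biset_hom_def by auto
  then show "biset_iso X Y f"
    using f g gf unfolding biset_iso_def biset_hom_def by blast
qed

lemma tensA_in: "x \<in> carr X \<Longrightarrow> y \<in> carr Y \<Longrightarrow> tensA X Y x y \<in> carr (tensorA X Y)"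
  unfolding tensA_def tensorA_def by (simp add: tens_in)

lemma carr_tensorAE:
  assumes "c \<in> carr (tensorA X Y)"
  obtains x y where "x \<in> carr X" "y \<in> carr Y" "c = tensA X Y x y"
  using assms unfolding tensA_def tensorA_def by (auto elim: tens_setE)

lemma tensA_balance:
  assumes "is_biset X" "is_biset Y" "x \<in> carr X" "y \<in> carr Y"
  shows "tensA X Y (ract X x a) y = tensA X Y x (lact Y a y)"
  unfolding tensA_def using assms by (intro tens_balance is_bisetD)

lemma lift_tens_tensA:
  assumes "x \<in> carr X" "y \<in> carr Y"
    and "\<And>x y a. x \<in> carr X \<Longrightarrow> y \<in> carr Y \<Longrightarrow> f (ract X x a) y = f x (lact Y a y)"
  shows "lift_tens f (tensA X Y x y) = f x y"
  unfolding tensA_def using assms by (rule lift_tens_tens)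

text \<open>Each outer action touches one factor only and commutes there with the inner action being
  balanced, so it descends to classes.\<close>

lemma tensorA_acts:
  assumes "is_biset X" "is_biset Y" "x \<in> carr X" "y \<in> carr Y"
  shows "lact (tensorA X Y) a (tensA X Y x y) = tensA X Y (lact X a x) y"
    "ract (tensorA X Y) (tensA X Y x y) a = tensA X Y x (ract Y y a)"
proof -
  show "lact (tensorA X Y) a (tensA X Y x y) = tensA X Y (lact X a x) y"
    unfolding tensorA_def using assms
    by (simp, subst lift_tens_tensA)
      (auto simp: is_bisetD(1) tensA_balance simp flip: is_bisetD(7))
  show "ract (tensorA X Y) (tensA X Y x y) a = tensA X Y x (ract Y y a)"
    unfolding tensorA_def using assms
    by (simp, subst lift_tens_tensA) (auto simp: is_bisetD(2,7) tensA_balance)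
qed

lemma is_biset_tensorA:
  assumes "is_biset X" "is_biset Y"
  shows "is_biset (tensorA X Y)"
  unfolding is_biset_def[of "tensorA X Y"]
  using assms by (auto elim!: carr_tensorAE simp: tensorA_acts tensA_in is_bisetD)

text \<open>The map in question is the morphism \<open>E \<rightarrow> X\<close> that sends the unit to \<open>x\<close>.\<close>

definition free_biset :: "('a::monoid_mult, 'x) biset \<Rightarrow> 'x \<Rightarrow> bool" where
  "free_biset X x \<longleftrightarrow> is_biset X \<and> x \<in> carr X \<and>
     bij_betw (\<lambda>(a, b). ract X (lact X a x) b) UNIV (carr X)"

lemma free_bisetE:
  assumes "free_biset X x" "y \<in> carr X"
  obtains a b where "y = ract X (lact X a x) b"
  using assms unfolding free_biset_def bij_betw_def by fastforce

text \<open>For infinite \<open>A\<close> the product \<open>A \<times> A\<close> has the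
  cardinality of \<open>A\<close>, so a copy of the free biset fits into \<open>'u\<close>.\<close>

lemma free_biset_exists:
  fixes \<iota> :: "'a::monoid_mult \<Rightarrow> 'u"
  assumes "inj \<iota>" "infinite (UNIV :: 'a set)"
  obtains X :: "('a, 'u) biset" and x where "free_biset X x"
proof -
  obtain k :: "'a \<times> 'a \<Rightarrow> 'a" where "inj k"
    using card_of_Times_same_infinite[OF assms(2)] card_of_ordIso[of "UNIV :: ('a \<times> 'a) set" "UNIV :: 'a set"]
    by (auto simp: bij_betw_def)
  then obtain j :: "'a \<times> 'a \<Rightarrow> 'u" where j: "inj j"
    using assms(1) inj_compose by blast
  \<comment> \<open>The structure of \<open>A \<times> A\<close>, with left multiplication on the
    first and right multiplication on the second factor, transported along \<open>j\<close>. The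
    generator will be \<open>j (1, 1)\<close>.\<close>
  define X where "X = \<lparr> carr = range j,
    lact = (\<lambda>a x. j (a * fst (inv j x), snd (inv j x))),
    ract = (\<lambda>x a. j (fst (inv j x), snd (inv j x) * a)) \<rparr>"
  have "is_biset X"
    using j unfolding is_biset_def X_def by (auto simp: mult.assoc)
  moreover have "(\<lambda>(a, b). ract X (lact X a (j (1, 1))) b) = j"
    using j by (auto simp: X_def)
  ultimately have "free_biset X (j (1, 1))"
    using j unfolding free_biset_def by (simp add: X_def bij_betw_def)
  then show ?thesis ..
qed

section \<open>Identities in a skew monoidal monoid\<close>

context skew_monoidal_monoid
begin

section \<open>The elements \<open>\<mu>\<close> and \<open>\<delta>\<close>\<close>

lemma mu_eta: "\<mu> * \<eta> = 1"
proof -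
  have "\<mu> * \<eta> = Q \<epsilon> * Q \<eta>" by (simp add: \<mu>_def mult.assoc gamma_eta)
  then show ?thesis by (simp add: eps_eta Q_one flip: Q_mult)
qed

lemma eps_delta: "\<epsilon> * \<delta> = 1"
proof -
  have "\<epsilon> * \<delta> = T \<epsilon> * T \<eta>" by (simp add: \<delta>_def eps_gamma flip: mult.assoc)
  then show ?thesis by (simp add: eps_eta T_one flip: T_mult)
qed

lemma mu_T_eta: "\<mu> * T \<eta> = 1"
  by (simp add: \<mu>_def Qeps_gamma_Teta)

lemma mu_T: "T a * \<mu> = \<mu> * T (T a)"
proof -
  have "T a * \<mu> = Q \<epsilon> * (T a * \<gamma>)" by (simp add: \<mu>_def TQ_comm flip: mult.assoc)
  then show ?thesis by (simp add: \<mu>_def mult.assoc flip: gamma_TT)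
qed

lemma mu_Q: "\<mu> * Q a = Q a * \<mu>"
proof -
  have "\<mu> * Q a = Q (\<epsilon> * Q a) * \<gamma>" by (simp add: \<mu>_def mult.assoc gamma_Q Q_mult)
  then show ?thesis by (simp add: \<mu>_def Q_mult mult.assoc flip: eps_Q)
qed

lemma delta_Q: "\<delta> * Q a = Q (Q a) * \<delta>"
proof -
  have "\<delta> * Q a = \<gamma> * Q a * T \<eta>" by (simp add: \<delta>_def mult.assoc TQ_comm)
  then show ?thesis by (simp add: \<delta>_def gamma_Q flip: mult.assoc)
qed

lemma delta_T: "\<delta> * T a = T a * \<delta>"
proof -
  have "\<delta> * T a = \<gamma> * T (T a) * T \<eta>"
    by (simp add: \<delta>_def mult.assoc eta_T flip: T_mult)
  then show ?thesis by (simp add: \<delta>_def gamma_TT mult.assoc)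
qed

text \<open>The pentagon multiplied on the left by \<open>Q (\<epsilon> * \<epsilon>)\<close>. This
  is what makes \<open>G\<close> closed under multiplication.\<close>

lemma mu_mu: "\<mu> * \<mu> = \<mu> * T \<mu>"
proof -
  have "\<mu> * \<mu> = Q \<epsilon> * (\<gamma> * Q \<epsilon>) * \<gamma>"
    by (simp add: \<mu>_def mult.assoc)
  also have "\<dots> = Q (\<epsilon> * Q \<epsilon>) * \<gamma> ^ 2"
    by (simp add: gamma_Q Q_mult power2_eq_square mult.assoc)
  also have "\<dots> = Q \<epsilon> * Q (\<epsilon> * \<gamma>) * \<gamma> * T \<gamma>"
    unfolding eps_Q[symmetric] pentagon[symmetric] by (simp add: Q_mult mult.assoc)
  also have "\<dots> = Q \<epsilon> * (Q (T \<epsilon>) * \<gamma>) * T \<gamma>"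
    by (simp add: eps_gamma mult.assoc)
  also have "\<dots> = \<mu> * T \<mu>"
    unfolding gamma_TQ[symmetric] by (simp add: \<mu>_def T_mult mult.assoc)
  finally show ?thesis .
qed

text \<open>The pentagon multiplied on the right by \<open>T (\<eta> * \<eta>)\<close>.\<close>

lemma delta_delta: "\<delta> * \<delta> = Q \<delta> * \<delta>"
proof -
  have "\<delta> * \<delta> = \<gamma> * (T \<eta> * \<gamma>) * T \<eta>"
    by (simp add: \<delta>_def mult.assoc)
  also have "\<dots> = \<gamma> ^ 2 * T (T \<eta> * \<eta>)"
    by (simp add: power2_eq_square T_mult mult.assoc flip: gamma_TT)
  also have "\<dots> = Q \<gamma> * \<gamma> * T (\<gamma> * \<eta>) * T \<eta>"
    by (simp add: T_mult mult.assoc flip: pentagon eta_T)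
  also have "\<dots> = Q \<gamma> * (\<gamma> * T (Q \<eta>)) * T \<eta>"
    by (simp add: gamma_eta mult.assoc)
  also have "\<dots> = Q \<delta> * \<delta>"
    by (simp add: gamma_TQ \<delta>_def Q_mult mult.assoc)
  finally show ?thesis .
qed

text \<open>The pentagon multiplied by \<open>Q \<epsilon>\<close> on the left and by
  \<open>T \<eta>\<close> on the right.\<close>

lemma mu_delta: "\<mu> * \<delta> = \<gamma>"
proof -
  have "\<mu> * \<delta> = Q \<epsilon> * (\<gamma> ^ 2) * T \<eta>"
    by (simp add: \<mu>_def \<delta>_def power2_eq_square mult.assoc)
  also have "\<dots> = Q (\<epsilon> * \<gamma>) * \<gamma> * T (\<gamma> * \<eta>)"
    by (simp add: Q_mult T_mult mult.assoc flip: pentagon)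
  also have "\<dots> = \<gamma> * T (Q \<epsilon> * Q \<eta>)"
    unfolding eps_gamma gamma_eta gamma_TQ[symmetric] by (simp add: T_mult mult.assoc)
  finally show ?thesis by (simp add: eps_eta Q_one T_one flip: Q_mult)
qed

section \<open>The target morphism \<open>S\<close>\<close>

text \<open>The mirror image of the definition of \<open>S\<close>: reversing products and
  exchanging \<open>T\<close> with \<open>Q\<close> and \<open>\<eta>\<close> with
  \<open>\<epsilon>\<close> fixes \<open>S\<close>, so one morphism serves both
  bialgebroids.\<close>

lemma S_eq: "S a = Q (\<epsilon> * T a) * \<delta>"
  by (simp add: S_def \<mu>_def \<delta>_def Q_mult T_mult mult.assoc)
    (simp add: gamma_TQ flip: mult.assoc)

lemma S_T: "S a * T b = T b * S a"
  by (simp add: S_eq mult.assoc delta_T) (simp add: TQ_comm flip: mult.assoc)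

lemma S_Q: "S a * Q b = Q b * S a"
  by (simp add: S_def mult.assoc TQ_comm) (simp add: mu_Q flip: mult.assoc)

lemma S_eta: "S a * \<eta> = Q a * \<eta>"
proof -
  have "S a * \<eta> = \<mu> * \<eta> * (Q a * \<eta>)" by (simp add: S_def mult.assoc eta_T)
  then show ?thesis by (simp add: mu_eta)
qed

lemma S_mu: "S a * \<mu> = \<mu> * T (S a)"
proof -
  have "S a * \<mu> = \<mu> * \<mu> * T (T (Q a * \<eta>))" by (simp add: S_def mult.assoc mu_T)
  then show ?thesis by (simp add: mu_mu S_def T_mult mult.assoc)
qed

lemma delta_S: "\<delta> * S a = Q (S a) * \<delta>"
proof -
  have "\<delta> * S a = Q (Q (\<epsilon> * T a)) * (\<delta> * \<delta>)" by (simp add: S_eq delta_Q flip: mult.assoc)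
  then show ?thesis by (simp add: delta_delta S_eq Q_mult mult.assoc)
qed

text \<open>By \<open>mu_mu\<close> the outer \<open>\<mu>\<close> enters the argument of
  \<open>T\<close>, where it passes \<open>Q a\<close> and cancels \<open>\<eta>\<close>. Hence the
  left action on \<open>G\<close>, right multiplication by \<open>S a\<close>, is left
  multiplication by \<open>Q a\<close> in the coordinate; \<open>S_delta\<close> does the same for
  the right action on \<open>F\<close>.\<close>

lemma mu_S: "\<mu> * S a = \<mu> * T (Q a)"
proof -
  have "\<mu> * S a = \<mu> * T (\<mu> * Q a * \<eta>)"
    by (simp add: S_def mu_mu T_mult flip: mult.assoc)
  also have "\<mu> * Q a * \<eta> = Q a"
    by (simp add: mu_Q mult.assoc mu_eta)
  finally show ?thesis .
qed

lemma S_delta: "S a * \<delta> = Q (T a) * \<delta>"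
proof -
  have "S a * \<delta> = Q (\<epsilon> * T a * \<delta>) * \<delta>"
    by (simp add: S_eq delta_delta Q_mult mult.assoc)
  also have "\<epsilon> * T a * \<delta> = T a"
    by (simp add: mult.assoc flip: delta_T) (simp add: eps_delta flip: mult.assoc)
  finally show ?thesis .
qed

text \<open>Passing \<open>\<delta>\<close> turns \<open>S a\<close> into \<open>Q (S a)\<close>,
  which commutes with \<open>\<mu>\<close>. This complements the intertwining axioms for
  \<open>\<gamma>\<close> when the fusion morphisms are inverted.\<close>

lemma gamma_S: "\<gamma> * S a = Q (S a) * \<gamma>"
  by (metis mu_delta mu_Q delta_S mult.assoc)

lemma gamma_TS: "\<gamma> * T (S a) = S a * \<gamma>"
  by (metis mu_delta S_mu delta_T mult.assoc)

lemma S_one: "S 1 = 1"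
  by (simp add: S_def Q_one mu_T_eta)

text \<open>\<open>S b\<close> passes \<open>\<mu>\<close> into the argument of \<open>T\<close>,
  commutes with \<open>Q a\<close> there, and becomes \<open>Q b\<close> in front of
  \<open>\<eta>\<close>.\<close>

lemma S_mult: "S (a * b) = S b * S a"
proof -
  have "S b * S a = \<mu> * T (S b * (Q a * \<eta>))"
    by (simp add: S_def[of a] T_mult S_mu flip: mult.assoc)
  also have "S b * (Q a * \<eta>) = Q (a * b) * \<eta>"
    unfolding mult.assoc[symmetric] S_Q by (simp add: S_eta Q_mult mult.assoc)
  finally show ?thesis by (simp add: S_def)
qed

text \<open>In a finite monoid the one-sided inverses of \<open>\<mu>\<close> and \<open>\<delta>\<close> are two-sided.\<close>

lemma gamma_unit_if_finite:
  assumes "finite (UNIV :: 'a set)"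
  shows "bij ((*) \<gamma>)" "bij (\<lambda>e. e * \<gamma>)"
proof -
  have "surj ((*) \<mu>)"
    using mu_eta by (intro surjI[of _ "(*) \<eta>"]) (simp flip: mult.assoc)
  moreover have "inj ((*) \<delta>)"
    using eps_delta by (intro inj_on_inverseI[of _ "(*) \<epsilon>"]) (simp flip: mult.assoc)
  ultimately have "bij ((*) \<mu>)" "bij ((*) \<delta>)"
    using assms by (simp_all add: bij_def finite_UNIV_surj_inj finite_UNIV_inj_surj)
  then have "bij ((*) \<mu> \<circ> (*) \<delta>)" by (rule bij_comp[rotated])
  then show "bij ((*) \<gamma>)" by (simp add: comp_def mu_delta flip: mult.assoc)
  have "surj (\<lambda>e. e * \<delta>)"
    using eps_delta by (intro surjI[of _ "\<lambda>e. e * \<epsilon>"]) (simp add: mult.assoc)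
  moreover have "inj (\<lambda>e. e * \<mu>)"
    using mu_eta by (intro inj_on_inverseI[of _ "\<lambda>e. e * \<eta>"]) (simp add: mult.assoc)
  ultimately have "bij (\<lambda>e. e * \<delta>)" "bij (\<lambda>e. e * \<mu>)"
    using assms by (simp_all add: bij_def finite_UNIV_surj_inj finite_UNIV_inj_surj)
  then have "bij ((\<lambda>e. e * \<delta>) \<circ> (\<lambda>e. e * \<mu>))" by (rule bij_comp[rotated])
  then show "bij (\<lambda>e. e * \<gamma>)" by (simp add: comp_def mu_delta mult.assoc)
qed

end

section \<open>Units and bijective translations\<close>

lemma bij_mult_left_iff_unit:
  fixes c :: "'a::monoid_mult"
  shows "bij ((*) c) \<longleftrightarrow> (\<exists>c'. c * c' = 1 \<and> c' * c = 1)"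
proof
  assume c: "bij ((*) c)"
  then obtain c' where c': "c * c' = 1" by (metis bij_pointE)
  then have "c * (c' * c) = c * 1" by (simp flip: mult.assoc)
  then have "c' * c = 1" using c by (metis bij_is_inj injD)
  with c' show "\<exists>c'. c * c' = 1 \<and> c' * c = 1" by blast
next
  assume "\<exists>c'. c * c' = 1 \<and> c' * c = 1"
  then obtain c' where "c * c' = 1" "c' * c = 1" by blast
  then show "bij ((*) c)"
    by (intro o_bij[of "(*) c'"]) (auto simp: fun_eq_iff simp flip: mult.assoc)
qed

lemma bij_mult_right_iff_unit:
  fixes c :: "'a::monoid_mult"
  shows "bij (\<lambda>e. e * c) \<longleftrightarrow> (\<exists>c'. c * c' = 1 \<and> c' * c = 1)"
proof
  assume c: "bij (\<lambda>e. e * c)"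
  then obtain c' where c': "c' * c = 1" by (metis bij_pointE)
  then have "(c * c') * c = 1 * c" by (simp add: mult.assoc)
  then have "c * c' = 1" using c by (metis bij_is_inj injD)
  with c' show "\<exists>c'. c * c' = 1 \<and> c' * c = 1" by blast
next
  assume "\<exists>c'. c * c' = 1 \<and> c' * c = 1"
  then obtain c' where "c * c' = 1" "c' * c = 1" by blast
  then show "bij (\<lambda>e. e * c)"
    by (intro o_bij[of "\<lambda>e. e * c'"]) (auto simp: fun_eq_iff mult.assoc)
qed

section \<open>The right bialgebroid\<close>

context skew_monoidal_monoid
begin

text \<open>The coordinate \<open>A \<cong> G\<close>, with inverse \<open>g \<mapsto> g \<eta>\<close>.\<close>

definition elG :: "'a \<Rightarrow> 'a" where "elG a = \<mu> * T a"

lemma elG_in: "elG a \<in> G"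
  by (simp add: elG_def G_def)

lemma G_E:
  assumes "g \<in> G"
  obtains a where "g = elG a"
  using assms by (auto simp: elG_def G_def)

lemma elG_eta: "elG a * \<eta> = a"
proof -
  have "elG a * \<eta> = \<mu> * \<eta> * a" by (simp add: elG_def mult.assoc eta_T)
  then show ?thesis by (simp add: mu_eta)
qed

lemma elG_1: "elG 1 = \<mu>"
  by (simp add: elG_def T_one)

lemma elG_T: "elG a * T b = elG (a * b)"
  by (simp add: elG_def T_mult mult.assoc)

lemma elG_S: "elG a * S b = elG (Q b * a)"
proof -
  have "elG a * S b = \<mu> * S b * T a" by (simp add: elG_def mult.assoc S_T)
  then show ?thesis by (simp add: mu_S elG_def T_mult mult.assoc)
qed

lemma T_elG: "T b * elG a = elG (T b * a)"
  by (simp add: elG_def mu_T T_mult flip: mult.assoc)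

lemma S_elG: "S b * elG a = elG (S b * a)"
  by (simp add: elG_def S_mu T_mult flip: mult.assoc)

lemma ST_elG: "S a * T b * elG c = elG (S a * T b * c)"
  by (simp add: mult.assoc T_elG S_elG)

lemma elG_mult: "elG a * elG b = elG (elG a * b)"
proof -
  have "elG a * elG b = \<mu> * (T a * \<mu>) * T b" by (simp add: elG_def mult.assoc)
  also have "\<dots> = \<mu> * \<mu> * T (T a) * T b" by (simp add: mu_T mult.assoc)
  also have "\<dots> = elG (elG a * b)" by (simp add: mu_mu elG_def T_mult mult.assoc)
  finally show ?thesis .
qed

text \<open>The source of \<open>\<gamma>\<close> in both the canonical map and the fusion morphism:
  comultiplication contributes \<open>\<delta>\<close>, multiplication in \<open>G\<close>
  contributes \<open>\<mu>\<close>.\<close>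

lemma elG_delta: "elG a * (\<delta> * b) = \<gamma> * (T a * b)"
proof -
  have "elG a * (\<delta> * b) = \<mu> * (\<delta> * T a) * b" by (simp add: elG_def mult.assoc delta_T)
  then show ?thesis by (simp add: mu_delta flip: mult.assoc)
qed

lemma elG_Q: "elG a * (Q b * c) = Q b * (elG a * c)"
proof -
  have "elG a * (Q b * c) = \<mu> * Q b * (T a * c)" by (simp add: elG_def mult.assoc TQ_comm[THEN arg_cong, of "\<lambda>x. x * c", unfolded mult.assoc])
  then show ?thesis by (simp add: mu_Q elG_def mult.assoc)
qed

section \<open>The canonical map of \<open>G\<close>\<close>

lemma carr_G_biset: "carr G_biset = G"
  by (simp add: G_biset_def)

lemma G_biset_acts: "lact G_biset a (elG c) = elG (Q a * c)" "ract G_biset (elG c) a = elG (c * a)"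
  by (simp_all add: G_biset_def elG_S elG_T)

lemma is_biset_G: "is_biset G_biset"
  unfolding is_biset_def carr_G_biset
  by (auto elim!: G_E simp: G_biset_acts elG_in Q_one Q_mult mult.assoc)

lemma comult_G_elG: "comult_G (elG c) = tensA G_biset G_biset (elG 1) (elG (\<delta> * c))"
  by (simp add: comult_G_def elG_1 mult.assoc elG_eta) (simp add: elG_def)

definition tensGG :: "'a \<Rightarrow> ('a \<times> 'a) set" where
  "tensGG c = tensA G_biset G_biset (elG 1) (elG c)"

lemma tensA_G: "tensA G_biset G_biset (elG a) (elG b) = tensGG (Q a * b)"
  using tensA_balance[OF is_biset_G is_biset_G, of "elG 1" "elG b" a]
  by (simp add: tensGG_def G_biset_acts carr_G_biset elG_in)

lemma bij_betw_tensGG: "bij_betw tensGG UNIV (carr (tensorA G_biset G_biset))"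
  unfolding tensGG_def[abs_def] tensA_def tensorA_def biset.simps
\<comment> \<open>The inverse coordinate: by \<open>tensA_G\<close> the first leg crosses the tensor
  sign as \<open>Q\<close> of its own coordinate.\<close>
proof (rule bij_betw_tens[where \<phi> = "\<lambda>g h. Q (g * \<eta>) * (h * \<eta>)"], unfold carr_G_biset)
  fix g h assume "g \<in> G" "h \<in> G"
  then show "\<exists>c\<in>UNIV. tens G G (ract G_biset) (lact G_biset) g h =
      tens G G (ract G_biset) (lact G_biset) (elG 1) (elG c)"
    using tensA_G unfolding tensA_def tensGG_def carr_G_biset by (blast elim: G_E)
qed (auto elim!: G_E simp: elG_in G_biset_acts elG_eta Q_one, simp add: Q_mult mult.assoc)

definition tensTG :: "'a \<Rightarrow> ('a \<times> 'a) set" where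
  "tensTG c = tens G G (\<lambda>g a. g * T a) (\<lambda>a h. T a * h) (elG 1) (elG c)"

lemma tens_T: "tens G G (\<lambda>g a. g * T a) (\<lambda>a h. T a * h) (elG a) (elG b) = tensTG (T a * b)"
  using tens_balance[of "elG 1" G "elG b" G "\<lambda>g a. g * T a" a "\<lambda>a h. T a * h"]
  by (simp add: tensTG_def elG_in elG_T T_elG)

lemma bij_betw_tensTG: "bij_betw tensTG UNIV G_tensor_T_G"
  unfolding G_tensor_T_G_def tensTG_def[abs_def]
proof (rule bij_betw_tens[where \<phi> = "\<lambda>g h. T (g * \<eta>) * (h * \<eta>)"])
  fix g h assume "g \<in> G" "h \<in> G"
  then show "\<exists>c\<in>UNIV. tens G G (\<lambda>g a. g * T a) (\<lambda>a h. T a * h) g h =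
      tens G G (\<lambda>g a. g * T a) (\<lambda>a h. T a * h) (elG 1) (elG c)"
    using tens_T unfolding tensTG_def by (blast elim: G_E)
qed (auto elim!: G_E simp: elG_in elG_T T_elG elG_eta T_one, simp add: T_mult mult.assoc)

text \<open>On \<open>elG a\<close> and \<open>elG b\<close> the map has coordinate
  \<open>\<gamma> * T a * b\<close>, which depends only on \<open>T a * b\<close>, the coordinate of
  the source.\<close>

lemma can_G_tensTG: "can_G (tensTG c) = tensGG (\<gamma> * c)"
proof -
  have *: "lift_tens (\<lambda>h1 h2. tensA G_biset G_biset h1 (elG a * h2)) (comult_G (elG b)) =
      tensGG (\<gamma> * T a * b)" for a b
    unfolding comult_G_elG
    by (subst lift_tens_tensA)
      (auto simp: carr_G_biset G_biset_acts elG_in elG_mult elG_delta elG_Q tensA_G Q_one Q_mult mult.assoc elim!: G_E)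
  show ?thesis
    unfolding can_G_def tensTG_def
    by (subst lift_tens_tens) (auto simp: * elG_in elG_T T_elG T_mult T_one simp flip: mult.assoc elim!: G_E)
qed

lemma can_G_bij_iff: "bij_betw can_G G_tensor_T_G (carr (tensorA G_biset G_biset)) \<longleftrightarrow> bij ((*) \<gamma>)"
  by (rule bij_betw_conjugate[OF bij_betw_tensTG bij_betw_tensGG]) (simp_all add: can_G_tensTG)

section \<open>The monad \<open>That\<close> in coordinates\<close>

lemma tensE_G_in: "x \<in> carr X \<Longrightarrow> tensE_G X x (elG c) \<in> carr (That X)"
  unfolding tensE_G_def That_def by (simp add: tens_in elG_in)

lemma carr_That_E:
  assumes "p \<in> carr (That X)"
  obtains x c where "x \<in> carr X" "p = tensE_G X x (elG c)"
  using assms unfolding That_def tensE_G_def by (auto elim!: tens_setE G_E)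

lemma tensE_G_balance:
  assumes "is_biset X" "x \<in> carr X"
  shows "tensE_G X (ract X (lact X a x) b) (elG c) = tensE_G X x (elG (S a * T b * c))"
  using tens_balance[of x "carr X" "elG c" G "\<lambda>x (a1, a2). ract X (lact X a1 x) a2" "(a, b)"
      "\<lambda>(a1, a2) g. S a1 * T a2 * g"] assms
  unfolding tensE_G_def by (simp add: elG_in is_bisetD ST_elG)

lemma tensE_G_lact:
  assumes "is_biset X" "x \<in> carr X"
  shows "tensE_G X (lact X a x) (elG c) = tensE_G X x (elG (S a * c))"
  using tensE_G_balance[of X x a 1] assms by (simp add: is_bisetD T_one)

lemma tensE_G_ract:
  assumes "is_biset X" "x \<in> carr X"
  shows "tensE_G X (ract X x a) (elG c) = tensE_G X x (elG (T a * c))"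
  using tensE_G_balance[of X x 1 a] assms by (simp add: is_bisetD S_one)

lemma lift_tensE_G:
  assumes "x \<in> carr X"
    and "\<And>x c a b. x \<in> carr X \<Longrightarrow> f (ract X (lact X a x) b) (elG c) = f x (elG (S a * (T b * c)))"
  shows "lift_tens f (tensE_G X x (elG c)) = f x (elG c)"
  unfolding tensE_G_def
  by (rule lift_tens_tens) (auto simp: assms elG_in S_elG T_elG mult.assoc elim!: G_E)

lemma That_acts:
  assumes "is_biset X" "x \<in> carr X"
  shows "lact (That X) a (tensE_G X x (elG c)) = tensE_G X x (elG (Q a * c))"
    "ract (That X) (tensE_G X x (elG c)) a = tensE_G X x (elG (c * a))"
proof -
  \<comment> \<open>The left action descends to classes because \<open>Q a\<close> commutes with the
    scalars \<open>S b\<close> and \<open>T d\<close> of the relation.\<close>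
  have "S b * (T d * (Q a * c)) = Q a * (S b * (T d * c))" for a b c d
  proof -
    have "S b * (T d * (Q a * c)) = S b * Q a * (T d * c)"
      by (simp add: mult.assoc TQ_comm[THEN arg_cong, of "\<lambda>x. x * c", unfolded mult.assoc])
    then show ?thesis by (simp add: S_Q mult.assoc)
  qed
  then show "lact (That X) a (tensE_G X x (elG c)) = tensE_G X x (elG (Q a * c))"
    unfolding That_def using assms
    by (simp, subst lift_tensE_G) (auto simp: tensE_G_balance elG_S mult.assoc)
  show "ract (That X) (tensE_G X x (elG c)) a = tensE_G X x (elG (c * a))"
    unfolding That_def using assms
    by (simp, subst lift_tensE_G) (auto simp: tensE_G_balance elG_T mult.assoc)
qed

lemma is_biset_That:
  assumes "is_biset X"
  shows "is_biset (That X)"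
  unfolding is_biset_def[of "That X"]
  using assms by (auto elim!: carr_That_E simp: That_acts tensE_G_in Q_one Q_mult mult.assoc)

lemma That_mult_tensE_G:
  assumes "is_biset X" "x \<in> carr X"
  shows "That_mult X (tensE_G (That X) (tensE_G X x (elG c)) (elG d)) = tensE_G X x (elG (elG c * d))"
proof -
  have *: "lift_tens (\<lambda>x g. tensE_G X x (g * elG d)) (tensE_G X x (elG c)) = tensE_G X x (elG (elG c * d))"
    if "x \<in> carr X" for x c d
    using that assms(1)
    by (subst lift_tensE_G) (auto simp: tensE_G_balance elG_mult ST_elG simp flip: mult.assoc)
  \<comment> \<open>Balance of the outer tensor: \<open>Q a * (c * b)\<close> is the coordinate of
    \<open>elG c\<close> after the biaction of \<open>a\<close> and \<open>b\<close>.\<close>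
  have **: "elG (Q a * (c * b)) * d = elG c * (S a * (T b * d))" for a b c d
  proof -
    have "elG (Q a * (c * b)) = elG c * S a * T b"
      by (simp add: elG_S elG_T mult.assoc)
    then show ?thesis by (simp add: mult.assoc)
  qed
  show ?thesis
    unfolding That_mult_def using assms
    by (subst lift_tensE_G) (auto elim!: carr_That_E simp: * ** tensE_G_in That_acts mult.assoc)
qed

text \<open>Every element of \<open>That X \<otimes>\<^sub>A That Y\<close> has the form \<open>fusC X Y x y c\<close>, and every element of
  \<open>That (X \<otimes>\<^sub>A That Y)\<close> the form \<open>fusD X Y x y e\<close>.\<close>

definition fusC :: "('a, 'x) biset \<Rightarrow> ('a, 'y) biset \<Rightarrow> 'x \<Rightarrow> 'y \<Rightarrow> 'a \<Rightarrow> (('x \<times> 'a) set \<times> ('y \<times> 'a) set) set" where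
  "fusC X Y x y c = tensA (That X) (That Y) (tensE_G X x (elG 1)) (tensE_G Y y (elG c))"

definition fusD :: "('a, 'x) biset \<Rightarrow> ('a, 'y) biset \<Rightarrow> 'x \<Rightarrow> 'y \<Rightarrow> 'a \<Rightarrow> (('x \<times> ('y \<times> 'a) set) set \<times> 'a) set" where
  "fusD X Y x y e = tensE_G (tensorA X (That Y)) (tensA X (That Y) x (tensE_G Y y (elG 1))) (elG e)"

context
  fixes X :: "('a, 'x) biset" and Y :: "('a, 'y) biset"
  assumes X: "is_biset X" and Y: "is_biset Y"
begin

lemma fusC_eq:
  assumes "x \<in> carr X" "y \<in> carr Y"
  shows "tensA (That X) (That Y) (tensE_G X x (elG b)) (tensE_G Y y (elG c)) = fusC X Y x y (Q b * c)"
  using tensA_balance[OF is_biset_That[OF X] is_biset_That[OF Y], of "tensE_G X x (elG 1)" "tensE_G Y y (elG c)" b]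
    X Y assms
  by (simp add: fusC_def That_acts tensE_G_in)

lemma fusD_eq:
  assumes "x \<in> carr X" "y \<in> carr Y"
  shows "tensE_G (tensorA X (That Y)) (tensA X (That Y) x (tensE_G Y y (elG d))) (elG c) = fusD X Y x y (T d * c)"
  using tensE_G_ract[OF is_biset_tensorA[OF X is_biset_That[OF Y]],
      of "tensA X (That Y) x (tensE_G Y y (elG 1))" d c] X Y assms
  by (simp add: fusD_def tensorA_acts That_acts tensE_G_in tensA_in is_biset_That)

lemma carr_fusC_E:
  assumes "p \<in> carr (tensorA (That X) (That Y))"
  obtains x y c where "x \<in> carr X" "y \<in> carr Y" "p = fusC X Y x y c"
proof -
  obtain x y b c where xy: "x \<in> carr X" "y \<in> carr Y"
    and p: "p = tensA (That X) (That Y) (tensE_G X x (elG b)) (tensE_G Y y (elG c))"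
    using assms by (elim carr_tensorAE carr_That_E) blast
  then show ?thesis using that[OF xy] fusC_eq[OF xy] by simp
qed

lemma carr_fusD_E:
  assumes "p \<in> carr (That (tensorA X (That Y)))"
  obtains x y e where "x \<in> carr X" "y \<in> carr Y" "p = fusD X Y x y e"
proof -
  obtain x y d c where xy: "x \<in> carr X" "y \<in> carr Y"
    and p: "p = tensE_G (tensorA X (That Y)) (tensA X (That Y) x (tensE_G Y y (elG d))) (elG c)"
    using assms by (elim carr_tensorAE carr_That_E) blast
  then show ?thesis using that[OF xy] fusD_eq[OF xy] by simp
qed

lemma fusC_in: "x \<in> carr X \<Longrightarrow> y \<in> carr Y \<Longrightarrow> fusC X Y x y c \<in> carr (tensorA (That X) (That Y))"
  by (simp add: fusC_def tensA_in tensE_G_in)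

lemma fusD_in: "x \<in> carr X \<Longrightarrow> y \<in> carr Y \<Longrightarrow> fusD X Y x y e \<in> carr (That (tensorA X (That Y)))"
  by (simp add: fusD_def tensA_in tensE_G_in)

text \<open>The left action enters the first leg as \<open>Q a\<close> and gains another
  \<open>Q\<close> when it crosses to the second leg.\<close>

lemma fusC_acts:
  assumes "x \<in> carr X" "y \<in> carr Y"
  shows "lact (tensorA (That X) (That Y)) a (fusC X Y x y c) = fusC X Y x y (Q (Q a) * c)"
    "ract (tensorA (That X) (That Y)) (fusC X Y x y c) a = fusC X Y x y (c * a)"
  using X Y assms
  by (simp_all add: fusC_def[of X Y x y c] tensorA_acts That_acts is_biset_That tensE_G_in)
    (simp_all add: fusC_eq Q_one)

lemma fusD_acts:
  assumes "x \<in> carr X" "y \<in> carr Y"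
  shows "lact (That (tensorA X (That Y))) a (fusD X Y x y e) = fusD X Y x y (Q a * e)"
    "ract (That (tensorA X (That Y))) (fusD X Y x y e) a = fusD X Y x y (e * a)"
  using X Y assms
  by (simp_all add: fusD_def That_acts is_biset_That is_biset_tensorA tensA_in tensE_G_in)

lemma That_opmon_tensE_G:
  assumes "x \<in> carr X" "y \<in> carr Y"
  shows "That_opmon X Y (tensE_G (tensorA X Y) (tensA X Y x y) (elG c)) = fusC X Y x y (\<delta> * c)"
proof -
  have 1: "lift_tens (\<lambda>g1 g2. tensA (That X) (That Y) (tensE_G X x g1) (tensE_G Y y g2)) (comult_G (elG c))
      = fusC X Y x y (\<delta> * c)"
    if "x \<in> carr X" "y \<in> carr Y" for x y c
    unfolding comult_G_elG using that
    by (subst lift_tens_tensA)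
      (auto elim!: G_E simp: carr_G_biset elG_in G_biset_acts fusC_eq Q_one Q_mult mult.assoc)
  have fusC_ract: "fusC X Y (ract X x a) y c = fusC X Y x y (Q (T a) * c)"
    and fusC_lact: "fusC X Y (lact X a x) y c = fusC X Y x y (Q (S a) * c)"
    and fusC_lact': "fusC X Y x (lact Y a y) c = fusC X Y x y (S a * c)"
    and fusC_ract': "fusC X Y x (ract Y y a) c = fusC X Y x y (T a * c)"
    if "x \<in> carr X" "y \<in> carr Y" for x y a c
    using X Y that
    by (simp_all add: fusC_def[of X Y "ract X x a"] fusC_def[of X Y "lact X a x"]
        fusC_def[of X Y x "lact Y a y"] fusC_def[of X Y x "ract Y y a"]
        tensE_G_lact tensE_G_ract fusC_eq Q_one)
  \<comment> \<open>Balance over \<open>X \<otimes> Y\<close>: a scalar contributes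
    \<open>Q (T a)\<close> when it acts on \<open>x\<close> and \<open>S a\<close> when it acts on
    \<open>y\<close>; in front of \<open>\<delta>\<close> the two agree.\<close>
  have S_delta': "S a * (\<delta> * c) = Q (T a) * (\<delta> * c)" for a c
    by (simp add: S_delta flip: mult.assoc)
  have 2: "lift_tens (\<lambda>x y. lift_tens (\<lambda>g1 g2. tensA (That X) (That Y) (tensE_G X x g1) (tensE_G Y y g2))
       (comult_G (elG c))) (tensA X Y x y) = fusC X Y x y (\<delta> * c)"
    if "x \<in> carr X" "y \<in> carr Y" for x y c
    using X Y that
    by (subst lift_tens_tensA) (auto simp: 1 is_bisetD fusC_ract fusC_lact' S_delta')
  \<comment> \<open>Balance over \<open>E\<close>: the scalars produced by acting on
    \<open>x \<otimes> y\<close> pass \<open>\<delta>\<close> and become those of the relation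
    defining the source.\<close>
  have *: "Q (S a) * (T b * (\<delta> * c)) = \<delta> * (S a * (T b * c))" for a b c
  proof -
    have "Q (S a) * (T b * (\<delta> * c)) = Q (S a) * \<delta> * (T b * c)"
      by (simp add: mult.assoc delta_T[THEN arg_cong, of "\<lambda>x. x * c", unfolded mult.assoc])
    then show ?thesis by (simp add: delta_S[symmetric] mult.assoc)
  qed
  show ?thesis
    unfolding That_opmon_def using X Y assms
    by (subst lift_tensE_G)
      (auto elim!: carr_tensorAE simp: 2 tensA_in tensorA_acts is_bisetD fusC_lact fusC_ract' *)
qed

end

text \<open>Reopened so that the type of \<open>Y\<close> in the preceding lemma can be instantiated.\<close>

context
  fixes X :: "('a, 'x) biset" and Y :: "('a, 'y) biset"
  assumes X: "is_biset X" and Y: "is_biset Y"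
begin

lemma left_fusion_G_fusD:
  assumes "x \<in> carr X" "y \<in> carr Y"
  shows "left_fusion_G X Y (fusD X Y x y e) = fusC X Y x y (\<gamma> * e)"
proof -
  \<comment> \<open>Left linearity of the multiplication lets its tensor product with the identity
    descend to classes.\<close>
  have 1: "That_mult Y z \<in> carr (That Y)"
      "That_mult Y (lact (That (That Y)) a z) = lact (That Y) a (That_mult Y z)"
    if "z \<in> carr (That (That Y))" for z a
    using that Y
    by (auto elim!: carr_That_E simp: That_mult_tensE_G That_acts is_biset_That tensE_G_in elG_Q)
  have "That_opmon X (That Y) (fusD X Y x y e) = fusC X (That Y) x (tensE_G Y y (elG 1)) (\<delta> * e)"
    using That_opmon_tensE_G[OF X is_biset_That[OF Y]] assms by (simp add: fusD_def tensE_G_in)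
  moreover have "tensor_map (That X) (That Y) id (That_mult Y) (fusC X (That Y) x (tensE_G Y y (elG 1)) (\<delta> * e))
      = fusC X Y x y (\<gamma> * e)"
    unfolding tensor_map_def fusC_def[of X "That Y"] using X Y assms
    by (subst lift_tens_tensA)
      (simp_all add: 1 tensA_balance is_biset_That tensE_G_in That_mult_tensE_G elG_delta T_one fusC_def)
  ultimately show ?thesis by (simp add: left_fusion_G_def)
qed

lemma biset_hom_left_fusion_G:
  "biset_hom (That (tensorA X (That Y))) (tensorA (That X) (That Y)) (left_fusion_G X Y)"
proof -
  \<comment> \<open>The left action is \<open>Q a\<close> on the source and \<open>Q (Q a)\<close>
    on the target. On the right both are right multiplication, which commutes with left
    multiplication by \<open>\<gamma>\<close>.\<close>
  have "\<gamma> * (Q a * e) = Q (Q a) * (\<gamma> * e)" for a e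
    by (simp add: gamma_Q flip: mult.assoc)
  then show ?thesis
    unfolding biset_hom_def
    by (auto elim!: carr_fusD_E[OF X Y] simp: left_fusion_G_fusD fusD_acts[OF X Y] fusC_acts[OF X Y]
        fusC_in[OF X Y] mult.assoc)
qed

lemma biset_iso_left_fusion_G_iff:
  "biset_iso (That (tensorA X (That Y))) (tensorA (That X) (That Y)) (left_fusion_G X Y) \<longleftrightarrow>
    bij_betw (left_fusion_G X Y) (carr (That (tensorA X (That Y)))) (carr (tensorA (That X) (That Y)))"
  using biset_iso_iff[OF is_biset_That[OF is_biset_tensorA[OF X is_biset_That[OF Y]]]]
    biset_hom_left_fusion_G by blast

lemma fusD_lact:
  assumes "x \<in> carr X" "y \<in> carr Y"
  shows "fusD X Y (lact X a x) y e = fusD X Y x y (S a * e)"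
  using tensE_G_lact[OF is_biset_tensorA[OF X is_biset_That[OF Y]],
      of "tensA X (That Y) x (tensE_G Y y (elG 1))" a e] X Y assms
  by (simp add: fusD_def tensorA_acts is_biset_That tensE_G_in tensA_in)

lemma fusD_ract:
  assumes "x \<in> carr X" "y \<in> carr Y"
  shows "fusD X Y (ract X x a) y e = fusD X Y x y (T (Q a) * e)"
  using tensA_balance[OF X is_biset_That[OF Y], of x "tensE_G Y y (elG 1)" a] Y assms
  by (simp add: fusD_def[of X Y "ract X x a"] That_acts tensE_G_in fusD_eq[OF X Y])

lemma fusD_biact:
  assumes "x \<in> carr X" "y \<in> carr Y"
  shows "fusD X Y x (ract Y (lact Y a y) b) e = fusD X Y x y (T (S a * T b) * e)"
  using tensE_G_balance[OF Y assms(2), of a b 1] assms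
  by (simp add: fusD_def[of X Y x "ract Y (lact Y a y) b"] fusD_eq[OF X Y])

text \<open>The scalars occurring in the defining relations of source and target of the fusion morphism
  are intertwined by \<open>\<gamma>\<close>, hence by \<open>\<gamma>'\<close> in the other direction.\<close>

lemma bij_betw_left_fusion_G:
  assumes "\<gamma> * \<gamma>' = 1" "\<gamma>' * \<gamma> = 1"
  shows "bij_betw (left_fusion_G X Y) (carr (That (tensorA X (That Y)))) (carr (tensorA (That X) (That Y)))"
proof -
  have cancel: "\<gamma> * (\<gamma>' * a) = a" "\<gamma>' * (\<gamma> * a) = a" for a
    using assms by (simp_all flip: mult.assoc)
  have swap: "b * (\<gamma>' * e) = \<gamma>' * (c * e)" if "\<gamma> * b = c * \<gamma>" for b c e
  proof -
    have "c * e = \<gamma> * (b * (\<gamma>' * e))"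
      using that assms(1) by (metis mult.assoc mult_1_right)
    then show ?thesis by (simp add: cancel)
  qed
  \<comment> \<open>The candidate inverse on representatives:
    \<open>Q (g * \<eta>) * (h * \<eta>)\<close> is the coordinate of the given tensor in the form
    \<open>fusC\<close>, and \<open>\<gamma>'\<close> undoes the fusion. It is lifted over
    \<open>y\<close> and \<open>h\<close>, then over \<open>x\<close> and \<open>g\<close>, then
    over the outer tensor.\<close>
  let ?B = "\<lambda>x g y h. fusD X Y x y (\<gamma>' * (Q (g * \<eta>) * (h * \<eta>)))"
  define \<beta> where "\<beta> = lift_tens (\<lambda>p q. lift_tens (\<lambda>x g. lift_tens (?B x g) q) p)"
  have 1: "lift_tens (\<lambda>y h. fusD X Y x y (\<gamma>' * (Q b * (h * \<eta>)))) (tensE_G Y y (elG c)) = fusD X Y x y (\<gamma>' * (Q b * c))"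
    if "x \<in> carr X" "y \<in> carr Y" for x y b c
  proof -
    have "T (S a * T d) * (\<gamma>' * (Q b * c)) = \<gamma>' * (Q b * (S a * (T d * c)))" for a b c d
    proof -
      have "\<gamma> * T (S a * T d) = S a * T d * \<gamma>"
        by (simp add: T_mult gamma_TT gamma_TS mult.assoc flip: mult.assoc[of \<gamma>])
      from swap[OF this] have "T (S a * T d) * (\<gamma>' * (Q b * c)) = \<gamma>' * (S a * T d * Q b * c)"
        by (simp add: mult.assoc)
      also have "S a * T d * Q b = Q b * S a * T d"
        by (simp add: mult.assoc TQ_comm) (simp add: S_Q flip: mult.assoc)
      finally show ?thesis by (simp add: mult.assoc)
    qed
    then show ?thesis
      using that by (subst lift_tensE_G) (auto simp: elG_eta fusD_biact)
  qed
  have 2: "lift_tens (\<lambda>x g. lift_tens (?B x g) (tensE_G Y y (elG c))) (tensE_G X x (elG b))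
      = fusD X Y x y (\<gamma>' * (Q b * c))"
    if "x \<in> carr X" "y \<in> carr Y" for x y b c
  proof -
    \<comment> \<open>The scalars that an action on \<open>x\<close> contributes to the coordinate
      of \<open>fusD\<close> cross \<open>\<gamma>'\<close> and become \<open>Q\<close> of the
      scalars acting on the leg \<open>g\<close>.\<close>
    have *: "T (Q d) * (S a * (\<gamma>' * e)) = \<gamma>' * (Q (S a) * (Q (T d) * e))" for a d e
      by (simp add: swap[OF gamma_TQ] swap[OF gamma_S] S_T flip: mult.assoc[of "Q _"] Q_mult)
    have "fusD X Y (ract X (lact X a x) d) y (\<gamma>' * (Q b * c))
        = fusD X Y x y (\<gamma>' * (Q (S a * (T d * b)) * c))"
      if "x \<in> carr X" for x a b d
      using X that \<open>y \<in> carr Y\<close>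
      by (simp add: fusD_lact fusD_ract is_bisetD Q_mult mult.assoc *)
    then show ?thesis
      using that by (subst lift_tensE_G[where X = X]) (auto simp: 1 elG_eta is_bisetD(1,2)[OF X])
  qed
  have Q_mult': "Q a * (Q b * c) = Q (a * b) * c" for a b c
    by (simp add: Q_mult mult.assoc)
  have 3: "\<beta> (fusC X Y x y c) = fusD X Y x y (\<gamma>' * c)" if "x \<in> carr X" "y \<in> carr Y" for x y c
    unfolding \<beta>_def fusC_def using X Y that
    by (subst lift_tens_tensA)
      (auto elim!: carr_That_E simp: tensE_G_in That_acts 2 Q_one Q_mult')
  show ?thesis
  proof (rule bij_betw_byWitness[of _ \<beta>])
    show "\<forall>p\<in>carr (That (tensorA X (That Y))). \<beta> (left_fusion_G X Y p) = p"
      by (auto elim!: carr_fusD_E[OF X Y] simp: left_fusion_G_fusD 3 cancel)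
    show "\<forall>p\<in>carr (tensorA (That X) (That Y)). left_fusion_G X Y (\<beta> p) = p"
      by (auto elim!: carr_fusC_E[OF X Y] simp: left_fusion_G_fusD 3 cancel)
    show "left_fusion_G X Y ` carr (That (tensorA X (That Y))) \<subseteq> carr (tensorA (That X) (That Y))"
      by (auto elim!: carr_fusD_E[OF X Y] simp: left_fusion_G_fusD fusC_in[OF X Y])
    show "\<beta> ` carr (tensorA (That X) (That Y)) \<subseteq> carr (That (tensorA X (That Y)))"
      by (auto elim!: carr_fusC_E[OF X Y] simp: 3 fusD_in[OF X Y])
  qed
qed

end

section \<open>The fusion morphism of \<open>G\<close> on free bisets\<close>

text \<open>A free biset of rank one is a copy of \<open>E\<close>, so tensoring it with
  \<open>G\<close> over \<open>E\<close> gives \<open>G\<close>, which is \<open>A\<close> in the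
  coordinate.\<close>

lemma bij_betw_That_free:
  assumes "free_biset X x"
  shows "bij_betw (\<lambda>c. tensE_G X x (elG c)) UNIV (carr (That X))"
proof -
  have X: "is_biset X" "x \<in> carr X" using assms by (simp_all add: free_biset_def)
  \<comment> \<open>Freeness writes \<open>z\<close> uniquely as the translate of \<open>x\<close>
    by some \<open>a\<close> and \<open>b\<close>; these scalars are then moved across onto
    \<open>g\<close>.\<close>
  define \<phi> where "\<phi> z g = (case inv (\<lambda>(a, b). ract X (lact X a x) b) z of (a, b) \<Rightarrow> S a * T b * (g * \<eta>))"
    for z g
  have "inj (\<lambda>(a, b). ract X (lact X a x) b)"
    using assms by (simp add: free_biset_def bij_betw_def)
  from inv_f_f[OF this]
  have \<phi>: "\<phi> (ract X (lact X a x) b) (elG c) = S a * T b * c" for a b c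
    by (simp add: \<phi>_def elG_eta split: prod.splits)
      (metis (mono_tags, lifting) case_prod_conv old.prod.inject)
  have act: "ract X (lact X a' (ract X (lact X a x) b)) b' = ract X (lact X (a' * a) x) (b * b')"
    for a a' b b'
    using X by (simp add: is_bisetD)
  have \<phi>1: "\<phi> x (elG c) = c" for c
    using \<phi>[of 1 1 c] X by (simp add: is_bisetD S_one T_one)
  show ?thesis
    unfolding tensE_G_def That_def biset.simps
  proof (rule bij_betw_tens[where \<phi> = \<phi>])
    fix z g and s :: "'a \<times> 'a" assume "z \<in> carr X" "g \<in> G"
    moreover obtain a' b' where "s = (a', b')" by (cases s)
    \<comment> \<open>Balance of \<open>\<phi>\<close>: since \<open>S\<close> reverses products,
      the scalars applied last to \<open>x\<close> end up nearest to \<open>c\<close>.\<close>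
    moreover have "S (a' * a) * T (b * b') * c = S a * T b * (S a' * T b' * c)" for a b a' b' c
    proof -
      have "S a * (S a' * T b) * (T b' * c) = S a * T b * (S a' * T b' * c)"
        by (simp add: S_T[of a' b] mult.assoc)
      then show ?thesis by (simp add: S_mult T_mult mult.assoc)
    qed
    ultimately show "\<phi> ((\<lambda>x (a1, a2). ract X (lact X a1 x) a2) z s) g =
        \<phi> z ((\<lambda>(a1, a2) g. S a1 * T a2 * g) s g)"
      by (auto elim!: free_bisetE[OF assms] G_E simp: act ST_elG \<phi>)
  next
    fix z g assume "z \<in> carr X" "g \<in> G"
    then obtain a b c where "z = ract X (lact X a x) b" "g = elG c"
      by (blast elim: free_bisetE[OF assms] G_E)
    then show "\<exists>c\<in>UNIV. tens (carr X) G (\<lambda>x (a1, a2). ract X (lact X a1 x) a2)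
          (\<lambda>(a1, a2) g. S a1 * T a2 * g) z g =
        tens (carr X) G (\<lambda>x (a1, a2). ract X (lact X a1 x) a2)
          (\<lambda>(a1, a2) g. S a1 * T a2 * g) x (elG c)"
      using tensE_G_balance[OF X, unfolded tensE_G_def] by auto
  qed (simp_all add: X elG_in \<phi>1)
qed

text \<open>The right factor of \<open>X\<close>, a copy of \<open>A \<times> A\<close>, is absorbed
  into \<open>That Y\<close>, a copy of \<open>A\<close>. What remains is
  \<open>A \<times> A\<close> with the free actions, so \<open>That\<close> of it is again
  \<open>A\<close>.\<close>

lemma free_biset_tensorA_That:
  assumes Xx: "free_biset X x" and Yy: "free_biset Y y"
  shows "free_biset (tensorA X (That Y)) (tensA X (That Y) x (tensE_G Y y (elG 1)))"
proof -
  have X: "is_biset X" "x \<in> carr X" and Y: "is_biset Y" "y \<in> carr Y"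
    using assms by (simp_all add: free_biset_def)
  let ?i = "inv (\<lambda>(a, b). ract X (lact X a x) b)" and ?k = "inv (\<lambda>c. tensE_G Y y (elG c))"
  define \<phi> where "\<phi> z q = (fst (?i z), Q (snd (?i z)) * ?k q)" for z q
  have i: "?i (ract X (lact X a x) b) = (a, b)" for a b
    using Xx inv_f_f[of "\<lambda>(a, b). ract X (lact X a x) b" "(a, b)"]
    by (simp add: free_biset_def bij_betw_def)
  have k: "?k (tensE_G Y y (elG c)) = c" for c
    using bij_betw_That_free[OF Yy] inv_f_f[of "\<lambda>c. tensE_G Y y (elG c)" c]
    by (simp add: bij_betw_def)
  have \<phi>: "\<phi> (ract X (lact X a x) b) (tensE_G Y y (elG c)) = (a, Q b * c)" for a b c
    by (simp add: \<phi>_def i k)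
  have That_E: "\<exists>c. q = tensE_G Y y (elG c)" if "q \<in> carr (That Y)" for q
    using that bij_betw_That_free[OF Yy] by (auto simp: bij_betw_def)
  have "bij_betw (\<lambda>z. tensA X (That Y) (lact X (fst z) x) (tensE_G Y y (elG (snd z)))) UNIV
      (carr (tensorA X (That Y)))"
    unfolding tensA_def tensorA_def biset.simps
  proof (rule bij_betw_tens[where \<phi> = \<phi>])
    fix z q s assume "z \<in> carr X" "q \<in> carr (That Y)"
    moreover have "ract X (ract X (lact X a x) b) s = ract X (lact X a x) (b * s)" for a b
      using X by (simp add: is_bisetD)
    ultimately show "\<phi> (ract X z s) q = \<phi> z (lact (That Y) s q)"
      using Y by (auto elim!: free_bisetE[OF Xx] dest!: That_E simp: \<phi> That_acts Q_mult mult.assoc)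
  next
    fix z q assume "z \<in> carr X" "q \<in> carr (That Y)"
    then obtain a b c where zq: "z = ract X (lact X a x) b" "q = tensE_G Y y (elG c)"
      by (blast elim: free_bisetE[OF Xx] dest: That_E)
    have "tensA X (That Y) z q = tensA X (That Y) (lact X a x) (tensE_G Y y (elG (Q b * c)))"
      using X Y unfolding zq by (simp add: tensA_balance is_biset_That is_bisetD(1) tensE_G_in That_acts)
    then show "\<exists>w\<in>UNIV. tens (carr X) (carr (That Y)) (ract X) (lact (That Y)) z q =
        tens (carr X) (carr (That Y)) (ract X) (lact (That Y)) (lact X (fst w) x) (tensE_G Y y (elG (snd w)))"
      unfolding tensA_def by (intro bexI[of _ "(a, Q b * c)"]) simp_all
  next
    fix w :: "'a \<times> 'a"
    show "\<phi> (lact X (fst w) x) (tensE_G Y y (elG (snd w))) = w"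
      using \<phi>[of "fst w" 1 "snd w"] X by (simp add: is_bisetD Q_one)
  qed (use X Y in \<open>simp_all add: is_bisetD tensE_G_in\<close>)
  then show ?thesis
    using X Y
    by (simp add: free_biset_def is_biset_tensorA is_biset_That tensA_in tensE_G_in tensorA_acts
        is_bisetD(1) That_acts case_prod_unfold)
qed

lemma bij_betw_fusD:
  assumes "free_biset X x" "free_biset Y y"
  shows "bij_betw (fusD X Y x y) UNIV (carr (That (tensorA X (That Y))))"
  unfolding fusD_def[abs_def] using assms by (intro bij_betw_That_free free_biset_tensorA_That)

lemma bij_betw_fusC:
  assumes Xx: "free_biset X x" and Yy: "free_biset Y y"
  shows "bij_betw (fusC X Y x y) UNIV (carr (tensorA (That X) (That Y)))"
proof -
  have X: "is_biset X" "x \<in> carr X" and Y: "is_biset Y" "y \<in> carr Y"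
    using assms by (simp_all add: free_biset_def)
  let ?i = "inv (\<lambda>c. tensE_G X x (elG c))" and ?k = "inv (\<lambda>c. tensE_G Y y (elG c))"
  have i: "?i (tensE_G X x (elG c)) = c" and k: "?k (tensE_G Y y (elG c)) = c" for c
    using bij_betw_That_free[OF Xx] bij_betw_That_free[OF Yy]
      inv_f_f[of "\<lambda>c. tensE_G X x (elG c)" c] inv_f_f[of "\<lambda>c. tensE_G Y y (elG c)" c]
    by (simp_all add: bij_betw_def)
  have Ex: "\<exists>c. p = tensE_G X x (elG c)" if "p \<in> carr (That X)" for p
    using that bij_betw_That_free[OF Xx] by (auto simp: bij_betw_def)
  have Ey: "\<exists>c. q = tensE_G Y y (elG c)" if "q \<in> carr (That Y)" for q
    using that bij_betw_That_free[OF Yy] by (auto simp: bij_betw_def)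
  show ?thesis
    unfolding fusC_def[abs_def] tensA_def tensorA_def biset.simps
  proof (rule bij_betw_tens[where \<phi> = "\<lambda>p q. Q (?i p) * ?k q"])
    fix p q s assume "p \<in> carr (That X)" "q \<in> carr (That Y)"
    then show "Q (?i (ract (That X) p s)) * ?k q = Q (?i p) * ?k (lact (That Y) s q)"
      using X Y by (auto dest!: Ex Ey simp: That_acts i k Q_mult mult.assoc)
  next
    fix p q assume "p \<in> carr (That X)" "q \<in> carr (That Y)"
    then obtain b c where "p = tensE_G X x (elG b)" "q = tensE_G Y y (elG c)"
      using Ex Ey by blast
    then show "\<exists>w\<in>UNIV. tens (carr (That X)) (carr (That Y)) (ract (That X)) (lact (That Y)) p q =
        tens (carr (That X)) (carr (That Y)) (ract (That X)) (lact (That Y))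
          (tensE_G X x (elG 1)) (tensE_G Y y (elG w))"
      using fusC_eq[OF X(1) Y(1) X(2) Y(2)] unfolding fusC_def tensA_def by blast
  qed (use X Y in \<open>simp_all add: tensE_G_in i k Q_one\<close>)
qed

lemma left_Hopf_G_iff:
  fixes \<iota> :: "'a \<Rightarrow> 'u"
  assumes "inj \<iota>"
  shows "left_Hopf_G TYPE('u) \<longleftrightarrow> bij ((*) \<gamma>)"
proof
  assume L: "left_Hopf_G TYPE('u)"
  show "bij ((*) \<gamma>)"
  proof (cases "finite (UNIV :: 'a set)")
    \<comment> \<open>One test object suffices: with both arguments equal to a free biset, fusion is
      left multiplication by \<open>\<gamma>\<close> on \<open>A\<close>.\<close>
    case False
    from free_biset_exists[OF assms this]
    obtain X :: "('a, 'u) biset" and x where X: "free_biset X x" .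
    then have X': "is_biset X" "x \<in> carr X" by (simp_all add: free_biset_def)
    have "bij_betw (left_fusion_G X X) (carr (That (tensorA X (That X)))) (carr (tensorA (That X) (That X)))"
      using L X' biset_iso_left_fusion_G_iff[of X X] unfolding left_Hopf_G_def by blast
    then show ?thesis
      using bij_betw_conjugate[OF bij_betw_fusD[OF X X] bij_betw_fusC[OF X X],
          of "(*) \<gamma>" "left_fusion_G X X"]
      by (simp add: left_fusion_G_fusD X')
  qed (rule gamma_unit_if_finite)
next
  assume "bij ((*) \<gamma>)"
  then show "left_Hopf_G TYPE('u)"
    unfolding left_Hopf_G_def bij_mult_left_iff_unit
    by (auto simp: biset_iso_left_fusion_G_iff intro: bij_betw_left_fusion_G)
qed

end

section \<open>The left bialgebroid\<close>

context skew_monoidal_monoid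
begin

text \<open>The coordinate \<open>A \<cong> F\<close>, with inverse \<open>f \<mapsto> \<epsilon> f\<close>.\<close>

definition elF :: "'a \<Rightarrow> 'a" where "elF a = Q a * \<delta>"

lemma elF_in: "elF a \<in> F"
  by (simp add: elF_def F_def)

lemma F_E:
  assumes "f \<in> F"
  obtains a where "f = elF a"
  using assms by (auto simp: elF_def F_def)

lemma eps_elF: "\<epsilon> * elF a = a"
proof -
  have "\<epsilon> * elF a = a * (\<epsilon> * \<delta>)" by (simp add: elF_def eps_Q flip: mult.assoc)
  then show ?thesis by (simp add: eps_delta)
qed

lemma elF_1: "elF 1 = \<delta>"
  by (simp add: elF_def Q_one)

lemma Q_elF: "Q b * elF a = elF (b * a)"
  by (simp add: elF_def Q_mult mult.assoc)

lemma S_elF: "S b * elF a = elF (a * T b)"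
proof -
  have "S b * elF a = Q a * (S b * \<delta>)" by (simp add: elF_def S_Q flip: mult.assoc)
  then show ?thesis by (simp add: S_delta elF_def Q_mult mult.assoc)
qed

lemma elF_Q: "elF a * Q b = elF (a * Q b)"
  by (simp add: elF_def delta_Q Q_mult mult.assoc)

lemma elF_S: "elF a * S b = elF (a * S b)"
  by (simp add: elF_def delta_S Q_mult mult.assoc)

lemma elF_mult: "elF a * elF b = elF (a * elF b)"
proof -
  have "elF a * elF b = Q a * (\<delta> * Q b) * \<delta>" by (simp add: elF_def mult.assoc)
  also have "\<dots> = Q a * Q (Q b) * (\<delta> * \<delta>)" by (simp add: delta_Q mult.assoc)
  also have "\<dots> = elF (a * elF b)" by (simp add: delta_delta elF_def Q_mult mult.assoc)
  finally show ?thesis .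
qed

text \<open>The mirror source of \<open>\<gamma>\<close>: here comultiplication contributes
  \<open>\<mu>\<close>, and the element of \<open>F\<close> multiplied in contributes
  \<open>\<delta>\<close>.\<close>

lemma mu_elF: "b * \<mu> * elF a = b * Q a * \<gamma>"
proof -
  have "b * \<mu> * elF a = b * (\<mu> * Q a) * \<delta>" by (simp add: elF_def mult.assoc)
  also have "\<dots> = b * Q a * (\<mu> * \<delta>)" by (simp add: mu_Q mult.assoc)
  finally show ?thesis by (simp add: mu_delta)
qed

lemma T_elF: "c * T b * elF a = c * elF a * T b"
proof -
  have "c * T b * elF a = c * (T b * Q a) * \<delta>" by (simp add: elF_def mult.assoc)
  also have "\<dots> = c * Q a * (T b * \<delta>)" by (simp add: TQ_comm mult.assoc)
  finally show ?thesis by (simp add: delta_T[symmetric] elF_def mult.assoc)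
qed

section \<open>The canonical map of \<open>F\<close>\<close>

lemma carr_F_biset: "carr F_biset = F"
  by (simp add: F_biset_def)

lemma F_biset_acts: "lact F_biset a (elF c) = elF (a * c)" "ract F_biset (elF c) a = elF (c * T a)"
  by (simp_all add: F_biset_def Q_elF S_elF)

lemma is_biset_F: "is_biset F_biset"
  unfolding is_biset_def carr_F_biset
  by (auto elim!: F_E simp: F_biset_acts elF_in T_one T_mult mult.assoc)

lemma comult_F_elF: "comult_F (elF c) = tensA F_biset F_biset (elF (c * \<mu>)) (elF 1)"
  by (simp add: comult_F_def elF_1 eps_elF) (simp add: elF_def)

definition tensFF :: "'a \<Rightarrow> ('a \<times> 'a) set" where
  "tensFF c = tensA F_biset F_biset (elF c) (elF 1)"

lemma tensA_F: "tensA F_biset F_biset (elF a) (elF b) = tensFF (a * T b)"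
  using tensA_balance[OF is_biset_F is_biset_F, of "elF a" "elF 1" b]
  by (simp add: tensFF_def F_biset_acts carr_F_biset elF_in)

lemma bij_betw_tensFF: "bij_betw tensFF UNIV (carr (tensorA F_biset F_biset))"
  unfolding tensFF_def[abs_def] tensA_def tensorA_def biset.simps
\<comment> \<open>Now the second leg crosses to the first, as \<open>T\<close> of its
  coordinate.\<close>
proof (rule bij_betw_tens[where \<phi> = "\<lambda>f h. (\<epsilon> * f) * T (\<epsilon> * h)"], unfold carr_F_biset)
  fix f h assume "f \<in> F" "h \<in> F"
  then show "\<exists>c\<in>UNIV. tens F F (ract F_biset) (lact F_biset) f h =
      tens F F (ract F_biset) (lact F_biset) (elF c) (elF 1)"
    using tensA_F unfolding tensA_def tensFF_def carr_F_biset by (blast elim: F_E)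
qed (auto elim!: F_E simp: elF_in F_biset_acts eps_elF T_one, simp add: T_mult mult.assoc)

definition tensQF :: "'a \<Rightarrow> ('a \<times> 'a) set" where
  "tensQF c = tens F F (\<lambda>f a. f * Q a) (\<lambda>a f'. Q a * f') (elF c) (elF 1)"

lemma tens_Q: "tens F F (\<lambda>f a. f * Q a) (\<lambda>a f'. Q a * f') (elF a) (elF b) = tensQF (a * Q b)"
  using tens_balance[of "elF a" F "elF 1" F "\<lambda>f a. f * Q a" b "\<lambda>a f'. Q a * f'"]
  by (simp add: tensQF_def elF_in elF_Q Q_elF)

lemma bij_betw_tensQF: "bij_betw tensQF UNIV F_tensor_Q_F"
  unfolding F_tensor_Q_F_def tensQF_def[abs_def]
proof (rule bij_betw_tens[where \<phi> = "\<lambda>f h. (\<epsilon> * f) * Q (\<epsilon> * h)"])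
  fix f h assume "f \<in> F" "h \<in> F"
  then show "\<exists>c\<in>UNIV. tens F F (\<lambda>f a. f * Q a) (\<lambda>a f'. Q a * f') f h =
      tens F F (\<lambda>f a. f * Q a) (\<lambda>a f'. Q a * f') (elF c) (elF 1)"
    using tens_Q unfolding tensQF_def by (blast elim: F_E)
qed (auto elim!: F_E simp: elF_in elF_Q Q_elF eps_elF Q_one, simp add: Q_mult mult.assoc)

text \<open>On \<open>elF a\<close> and \<open>elF b\<close> the coordinate is
  \<open>a * Q b * \<gamma>\<close>, a function of the source coordinate
  \<open>a * Q b\<close>.\<close>

lemma can_F_tensQF: "can_F (tensQF c) = tensFF (c * \<gamma>)"
proof -
  have *: "lift_tens (\<lambda>f1 f2. tensA F_biset F_biset (f1 * elF b) f2) (comult_F (elF a)) =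
      tensFF (a * Q b * \<gamma>)" for a b
    unfolding comult_F_elF
    by (subst lift_tens_tensA)
      (auto simp: carr_F_biset F_biset_acts elF_in elF_mult mu_elF T_elF tensA_F T_one T_mult
        simp flip: mult.assoc elim!: F_E)
  show ?thesis
    unfolding can_F_def tensQF_def
    by (subst lift_tens_tens) (auto simp: * elF_in elF_Q Q_elF Q_mult Q_one mult.assoc elim!: F_E)
qed

lemma can_F_bij_iff:
  "bij_betw can_F F_tensor_Q_F (carr (tensorA F_biset F_biset)) \<longleftrightarrow> bij (\<lambda>e. e * \<gamma>)"
  by (rule bij_betw_conjugate[OF bij_betw_tensQF bij_betw_tensFF]) (simp_all add: can_F_tensQF)

section \<open>The monad \<open>Fhat\<close> in coordinates\<close>

lemma tensE_F_in: "x \<in> carr X \<Longrightarrow> tensE_F X (elF c) x \<in> carr (Fhat X)"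
  unfolding tensE_F_def Fhat_def by (simp add: tens_in elF_in)

lemma carr_Fhat_E:
  assumes "p \<in> carr (Fhat X)"
  obtains x c where "x \<in> carr X" "p = tensE_F X (elF c) x"
  using assms unfolding Fhat_def tensE_F_def by (auto elim!: tens_setE F_E)

lemma tensE_F_balance:
  assumes "is_biset X" "x \<in> carr X"
  shows "tensE_F X (elF c) (ract X (lact X a x) b) = tensE_F X (elF (c * Q a * S b)) x"
  using tens_balance[of "elF c" F x "carr X" "\<lambda>f (a1, a2). f * Q a1 * S a2" "(a, b)"
      "\<lambda>(a1, a2) x. ract X (lact X a1 x) a2"] assms
  unfolding tensE_F_def by (simp add: elF_in is_bisetD elF_Q elF_S)

lemma tensE_F_lact:
  assumes "is_biset X" "x \<in> carr X"
  shows "tensE_F X (elF c) (lact X a x) = tensE_F X (elF (c * Q a)) x"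
  using tensE_F_balance[of X x c a 1] assms by (simp add: is_bisetD S_one)

lemma tensE_F_ract:
  assumes "is_biset X" "x \<in> carr X"
  shows "tensE_F X (elF c) (ract X x a) = tensE_F X (elF (c * S a)) x"
  using tensE_F_balance[of X x c 1 a] assms by (simp add: is_bisetD Q_one)

lemma lift_tensE_F:
  assumes "x \<in> carr X"
    and "\<And>x c a b. x \<in> carr X \<Longrightarrow> f (elF c) (ract X (lact X a x) b) = f (elF (c * Q a * S b)) x"
  shows "lift_tens f (tensE_F X (elF c) x) = f (elF c) x"
  unfolding tensE_F_def
  by (rule lift_tens_tens) (auto simp: assms elF_in elF_Q elF_S elim!: F_E)

lemma Fhat_acts:
  assumes "is_biset X" "x \<in> carr X"
  shows "lact (Fhat X) a (tensE_F X (elF c) x) = tensE_F X (elF (a * c)) x"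
    "ract (Fhat X) (tensE_F X (elF c) x) a = tensE_F X (elF (c * T a)) x"
proof -
  show "lact (Fhat X) a (tensE_F X (elF c) x) = tensE_F X (elF (a * c)) x"
    unfolding Fhat_def using assms
    by (simp, subst lift_tensE_F) (auto simp: tensE_F_balance Q_elF mult.assoc)
  \<comment> \<open>The right action descends because \<open>T a\<close> commutes with the scalars
    \<open>Q b\<close> and \<open>S d\<close>.\<close>
  have "c * Q b * S d * T a = c * T a * Q b * S d" for a b c d
    by (simp add: mult.assoc S_T) (simp add: TQ_comm flip: mult.assoc[of "T a"] mult.assoc[of "Q b"])
  then show "ract (Fhat X) (tensE_F X (elF c) x) a = tensE_F X (elF (c * T a)) x"
    unfolding Fhat_def using assms
    by (simp, subst lift_tensE_F) (auto simp: tensE_F_balance S_elF)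
qed

lemma is_biset_Fhat:
  assumes "is_biset X"
  shows "is_biset (Fhat X)"
  unfolding is_biset_def[of "Fhat X"]
  using assms by (auto elim!: carr_Fhat_E simp: Fhat_acts tensE_F_in T_one T_mult mult.assoc)

lemma Fhat_mult_tensE_F:
  assumes "is_biset X" "x \<in> carr X"
  shows "Fhat_mult X (tensE_F (Fhat X) (elF d) (tensE_F X (elF c) x)) = tensE_F X (elF (d * elF c)) x"
proof -
  have QS: "d * elF c * Q a * S b = d * elF (c * Q a * S b)" for a b c d
    unfolding elF_S[symmetric] elF_Q[symmetric] by (simp add: mult.assoc)
  have *: "lift_tens (\<lambda>f' x. tensE_F X (elF d * f') x) (tensE_F X (elF c) x) = tensE_F X (elF (d * elF c)) x"
    if "x \<in> carr X" for x c d
    using that assms(1)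
    by (subst lift_tensE_F) (auto simp: tensE_F_balance elF_mult QS)
  \<comment> \<open>Balance of the outer tensor: \<open>a * c * T b\<close> is the coordinate of
    \<open>elF c\<close> after the biaction of \<open>a\<close> and \<open>b\<close>.\<close>
  have **: "d * elF (a * c * T b) = d * Q a * S b * elF c" for a b c d
    by (simp add: mult.assoc S_elF Q_elF)
  show ?thesis
    unfolding Fhat_mult_def using assms
    by (subst lift_tensE_F) (auto elim!: carr_Fhat_E simp: * ** tensE_F_in Fhat_acts)
qed

text \<open>Normal forms for \<open>Fhat X \<otimes>\<^sub>A Fhat Y\<close> and for \<open>Fhat (Fhat X \<otimes>\<^sub>A Y)\<close>, as for \<open>fusC\<close> and
  \<open>fusD\<close>.\<close>

definition fusCF :: "('a, 'x) biset \<Rightarrow> ('a, 'y) biset \<Rightarrow> 'x \<Rightarrow> 'y \<Rightarrow> 'a \<Rightarrow> (('a \<times> 'x) set \<times> ('a \<times> 'y) set) set" where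
  "fusCF X Y x y c = tensA (Fhat X) (Fhat Y) (tensE_F X (elF c) x) (tensE_F Y (elF 1) y)"

definition fusDF :: "('a, 'x) biset \<Rightarrow> ('a, 'y) biset \<Rightarrow> 'x \<Rightarrow> 'y \<Rightarrow> 'a \<Rightarrow> ('a \<times> (('a \<times> 'x) set \<times> 'y) set) set" where
  "fusDF X Y x y e = tensE_F (tensorA (Fhat X) Y) (elF e) (tensA (Fhat X) Y (tensE_F X (elF 1) x) y)"

context
  fixes X :: "('a, 'x) biset" and Y :: "('a, 'y) biset"
  assumes X: "is_biset X" and Y: "is_biset Y"
begin

lemma fusCF_eq:
  assumes "x \<in> carr X" "y \<in> carr Y"
  shows "tensA (Fhat X) (Fhat Y) (tensE_F X (elF b) x) (tensE_F Y (elF c) y) = fusCF X Y x y (b * T c)"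
  using tensA_balance[OF is_biset_Fhat[OF X] is_biset_Fhat[OF Y], of "tensE_F X (elF b) x" "tensE_F Y (elF 1) y" c]
    X Y assms
  by (simp add: fusCF_def Fhat_acts tensE_F_in)

lemma fusDF_eq:
  assumes "x \<in> carr X" "y \<in> carr Y"
  shows "tensE_F (tensorA (Fhat X) Y) (elF c) (tensA (Fhat X) Y (tensE_F X (elF d) x) y) = fusDF X Y x y (c * Q d)"
  using tensE_F_lact[OF is_biset_tensorA[OF is_biset_Fhat[OF X] Y],
      of "tensA (Fhat X) Y (tensE_F X (elF 1) x) y" c d] X Y assms
  by (simp add: fusDF_def tensorA_acts Fhat_acts tensE_F_in tensA_in is_biset_Fhat)

lemma carr_fusCF_E:
  assumes "p \<in> carr (tensorA (Fhat X) (Fhat Y))"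
  obtains x y c where "x \<in> carr X" "y \<in> carr Y" "p = fusCF X Y x y c"
proof -
  obtain x y b c where xy: "x \<in> carr X" "y \<in> carr Y"
    and p: "p = tensA (Fhat X) (Fhat Y) (tensE_F X (elF b) x) (tensE_F Y (elF c) y)"
    using assms by (elim carr_tensorAE carr_Fhat_E) blast
  then show ?thesis using that[OF xy] fusCF_eq[OF xy] by simp
qed

lemma carr_fusDF_E:
  assumes "p \<in> carr (Fhat (tensorA (Fhat X) Y))"
  obtains x y e where "x \<in> carr X" "y \<in> carr Y" "p = fusDF X Y x y e"
proof -
  obtain x y d c where xy: "x \<in> carr X" "y \<in> carr Y"
    and p: "p = tensE_F (tensorA (Fhat X) Y) (elF c) (tensA (Fhat X) Y (tensE_F X (elF d) x) y)"
    using assms by (elim carr_tensorAE carr_Fhat_E) blast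
  then show ?thesis using that[OF xy] fusDF_eq[OF xy] by simp
qed

lemma fusCF_in: "x \<in> carr X \<Longrightarrow> y \<in> carr Y \<Longrightarrow> fusCF X Y x y c \<in> carr (tensorA (Fhat X) (Fhat Y))"
  by (simp add: fusCF_def tensA_in tensE_F_in)

lemma fusDF_in: "x \<in> carr X \<Longrightarrow> y \<in> carr Y \<Longrightarrow> fusDF X Y x y e \<in> carr (Fhat (tensorA (Fhat X) Y))"
  by (simp add: fusDF_def tensA_in tensE_F_in)

lemma fusCF_acts:
  assumes "x \<in> carr X" "y \<in> carr Y"
  shows "lact (tensorA (Fhat X) (Fhat Y)) a (fusCF X Y x y c) = fusCF X Y x y (a * c)"
    "ract (tensorA (Fhat X) (Fhat Y)) (fusCF X Y x y c) a = fusCF X Y x y (c * T (T a))"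
  using X Y assms
  by (simp_all add: fusCF_def[of X Y x y c] tensorA_acts Fhat_acts is_biset_Fhat tensE_F_in)
    (simp_all add: fusCF_eq T_one)

lemma fusDF_acts:
  assumes "x \<in> carr X" "y \<in> carr Y"
  shows "lact (Fhat (tensorA (Fhat X) Y)) a (fusDF X Y x y e) = fusDF X Y x y (a * e)"
    "ract (Fhat (tensorA (Fhat X) Y)) (fusDF X Y x y e) a = fusDF X Y x y (e * T a)"
  using X Y assms
  by (simp_all add: fusDF_def Fhat_acts is_biset_Fhat is_biset_tensorA tensA_in tensE_F_in)

lemma Fhat_opmon_tensE_F:
  assumes "x \<in> carr X" "y \<in> carr Y"
  shows "Fhat_opmon X Y (tensE_F (tensorA X Y) (elF c) (tensA X Y x y)) = fusCF X Y x y (c * \<mu>)"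
proof -
  have 1: "lift_tens (\<lambda>f1 f2. tensA (Fhat X) (Fhat Y) (tensE_F X f1 x) (tensE_F Y f2 y)) (comult_F (elF c))
      = fusCF X Y x y (c * \<mu>)"
    if "x \<in> carr X" "y \<in> carr Y" for x y c
    unfolding comult_F_elF using that
    by (subst lift_tens_tensA)
      (auto elim!: F_E simp: carr_F_biset elF_in F_biset_acts fusCF_eq T_one T_mult mult.assoc)
  have fusCF_ract: "fusCF X Y (ract X x a) y c = fusCF X Y x y (c * S a)"
    and fusCF_lact: "fusCF X Y (lact X a x) y c = fusCF X Y x y (c * Q a)"
    and fusCF_lact': "fusCF X Y x (lact Y a y) c = fusCF X Y x y (c * T (Q a))"
    and fusCF_ract': "fusCF X Y x (ract Y y a) c = fusCF X Y x y (c * T (S a))"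
    if "x \<in> carr X" "y \<in> carr Y" for x y a c
    using X Y that
    by (simp_all add: fusCF_def[of X Y "ract X x a"] fusCF_def[of X Y "lact X a x"]
        fusCF_def[of X Y x "lact Y a y"] fusCF_def[of X Y x "ract Y y a"]
        tensE_F_lact tensE_F_ract fusCF_eq T_one)
  \<comment> \<open>Balance over \<open>X \<otimes> Y\<close>: acting on \<open>x\<close>
    contributes \<open>S a\<close> and acting on \<open>y\<close> contributes
    \<open>T (Q a)\<close>, which agree after \<open>\<mu>\<close>.\<close>
  have mu_S': "c * \<mu> * S a = c * \<mu> * T (Q a)" for a c
    by (simp add: mu_S mult.assoc)
  have 2: "lift_tens (\<lambda>x y. lift_tens (\<lambda>f1 f2. tensA (Fhat X) (Fhat Y) (tensE_F X f1 x) (tensE_F Y f2 y))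
       (comult_F (elF c))) (tensA X Y x y) = fusCF X Y x y (c * \<mu>)"
    if "x \<in> carr X" "y \<in> carr Y" for x y c
    using X Y that
    by (subst lift_tens_tensA) (auto simp: 1 is_bisetD fusCF_ract fusCF_lact' mu_S')
  have *: "c * \<mu> * Q a * T (S b) = c * Q a * S b * \<mu>"
      "c * \<mu> * T (S b) * Q a = c * Q a * S b * \<mu>" for a b c
  proof -
    have "c * (\<mu> * Q a) * T (S b) = c * Q a * (\<mu> * T (S b))"
      by (simp add: mu_Q mult.assoc)
    then show "c * \<mu> * Q a * T (S b) = c * Q a * S b * \<mu>"
      by (simp add: S_mu[symmetric] mult.assoc)
    then show "c * \<mu> * T (S b) * Q a = c * Q a * S b * \<mu>"
      by (simp add: TQ_comm mult.assoc)
  qed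
  show ?thesis
    unfolding Fhat_opmon_def using X Y assms
    by (subst lift_tensE_F)
      (auto elim!: carr_tensorAE simp: 2 tensA_in tensorA_acts is_bisetD fusCF_lact fusCF_ract' *)
qed

end

text \<open>Reopened so that the type of \<open>X\<close> in the preceding lemma can be instantiated.\<close>

context
  fixes X :: "('a, 'x) biset" and Y :: "('a, 'y) biset"
  assumes X: "is_biset X" and Y: "is_biset Y"
begin

lemma right_fusion_F_fusDF:
  assumes "x \<in> carr X" "y \<in> carr Y"
  shows "right_fusion_F X Y (fusDF X Y x y e) = fusCF X Y x y (e * \<gamma>)"
proof -
  \<comment> \<open>Now the multiplication sits on the left leg, so its right linearity is what lets
    the tensor product of maps descend.\<close>
  have 1: "Fhat_mult X z \<in> carr (Fhat X)"
      "Fhat_mult X (ract (Fhat (Fhat X)) z a) = ract (Fhat X) (Fhat_mult X z) a"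
    if "z \<in> carr (Fhat (Fhat X))" for z a
    using that X
    by (auto elim!: carr_Fhat_E simp: Fhat_mult_tensE_F Fhat_acts is_biset_Fhat tensE_F_in T_elF)
  have "Fhat_opmon (Fhat X) Y (fusDF X Y x y e) = fusCF (Fhat X) Y (tensE_F X (elF 1) x) y (e * \<mu>)"
    using Fhat_opmon_tensE_F[OF is_biset_Fhat[OF X] Y] assms by (simp add: fusDF_def tensE_F_in)
  moreover have "tensor_map (Fhat X) (Fhat Y) (Fhat_mult X) id (fusCF (Fhat X) Y (tensE_F X (elF 1) x) y (e * \<mu>))
      = fusCF X Y x y (e * \<gamma>)"
    unfolding tensor_map_def fusCF_def[of "Fhat X"] using X Y assms
    by (subst lift_tens_tensA)
      (simp_all add: 1 tensA_balance is_biset_Fhat tensE_F_in Fhat_mult_tensE_F mu_elF Q_one fusCF_def)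
  ultimately show ?thesis by (simp add: right_fusion_F_def)
qed

text \<open>Left linearity is associativity. The right action is \<open>T a\<close> on the source
  and \<open>T (T a)\<close> on the target, matched by \<open>gamma_TT\<close>.\<close>

lemma biset_hom_right_fusion_F:
  "biset_hom (Fhat (tensorA (Fhat X) Y)) (tensorA (Fhat X) (Fhat Y)) (right_fusion_F X Y)"
  unfolding biset_hom_def
  by (auto elim!: carr_fusDF_E[OF X Y] simp: right_fusion_F_fusDF fusDF_acts[OF X Y] fusCF_acts[OF X Y]
      fusCF_in[OF X Y] gamma_TT mult.assoc)

lemma biset_iso_right_fusion_F_iff:
  "biset_iso (Fhat (tensorA (Fhat X) Y)) (tensorA (Fhat X) (Fhat Y)) (right_fusion_F X Y) \<longleftrightarrow>
    bij_betw (right_fusion_F X Y) (carr (Fhat (tensorA (Fhat X) Y))) (carr (tensorA (Fhat X) (Fhat Y)))"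
  using biset_iso_iff[OF is_biset_Fhat[OF is_biset_tensorA[OF is_biset_Fhat[OF X] Y]]]
    biset_hom_right_fusion_F by blast

lemma fusDF_ract:
  assumes "x \<in> carr X" "y \<in> carr Y"
  shows "fusDF X Y x (ract Y y a) e = fusDF X Y x y (e * S a)"
  using tensE_F_ract[OF is_biset_tensorA[OF is_biset_Fhat[OF X] Y],
      of "tensA (Fhat X) Y (tensE_F X (elF 1) x) y" e a] X Y assms
  by (simp add: fusDF_def tensorA_acts is_biset_Fhat tensE_F_in tensA_in)

lemma fusDF_lact:
  assumes "x \<in> carr X" "y \<in> carr Y"
  shows "fusDF X Y x (lact Y a y) e = fusDF X Y x y (e * Q (T a))"
  using tensA_balance[OF is_biset_Fhat[OF X] Y, of "tensE_F X (elF 1) x" y a, symmetric] X assms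
  by (simp add: fusDF_def[of X Y x "lact Y a y"] Fhat_acts tensE_F_in fusDF_eq[OF X Y])

lemma fusDF_biact:
  assumes "x \<in> carr X" "y \<in> carr Y"
  shows "fusDF X Y (ract X (lact X a x) b) y e = fusDF X Y x y (e * Q (Q a * S b))"
  using tensE_F_balance[OF X assms(1), of 1 a b] assms
  by (simp add: fusDF_def[of X Y "ract X (lact X a x) b"] fusDF_eq[OF X Y])

text \<open>Right multiplication by \<open>\<gamma>'\<close> undoes the fusion in coordinates; the
  intertwining relations for \<open>\<gamma>\<close> make it compatible with all defining relations
  of the target.\<close>

lemma bij_betw_right_fusion_F:
  assumes "\<gamma> * \<gamma>' = 1" "\<gamma>' * \<gamma> = 1"
  shows "bij_betw (right_fusion_F X Y) (carr (Fhat (tensorA (Fhat X) Y))) (carr (tensorA (Fhat X) (Fhat Y)))"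
proof -
  have cancel: "a * \<gamma> * \<gamma>' = a" "a * \<gamma>' * \<gamma> = a" for a
    using assms by (simp_all add: mult.assoc)
  have swap: "e * \<gamma>' * c = e * b * \<gamma>'" if "\<gamma> * b = c * \<gamma>" for b c e
  proof -
    have "e * b = e * \<gamma>' * c * \<gamma>"
      using that assms(2) by (metis mult.assoc mult_1_right)
    then show ?thesis by (simp add: cancel)
  qed
  let ?B = "\<lambda>f x h y. fusDF X Y x y ((\<epsilon> * f) * T (\<epsilon> * h) * \<gamma>')"
  \<comment> \<open>The order of lifting is mirrored: the class over \<open>X\<close> is resolved
    innermost, the one over \<open>Y\<close> around it.\<close>
  define \<beta> where "\<beta> = lift_tens (\<lambda>p q. lift_tens (\<lambda>h y. lift_tens (\<lambda>f x. ?B f x h y) p) q)"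
  have 1: "lift_tens (\<lambda>f x. fusDF X Y x y ((\<epsilon> * f) * T c * \<gamma>')) (tensE_F X (elF b) x) = fusDF X Y x y (b * T c * \<gamma>')"
    if "x \<in> carr X" "y \<in> carr Y" for x y b c
  proof -
    have "b * T c * \<gamma>' * Q (Q a * S d) = b * Q a * S d * T c * \<gamma>'" for a b c d
    proof -
      have "\<gamma> * (Q a * S d) = Q (Q a * S d) * \<gamma>"
        by (simp add: Q_mult gamma_S gamma_Q mult.assoc flip: mult.assoc[of \<gamma>])
      from swap[OF this] have "b * T c * \<gamma>' * Q (Q a * S d) = b * (T c * Q a * S d) * \<gamma>'"
        by (simp add: mult.assoc)
      also have "T c * Q a * S d = Q a * S d * T c"
        by (simp add: TQ_comm S_T mult.assoc)
      finally show ?thesis by (simp add: mult.assoc)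
    qed
    then show ?thesis
      using that by (subst lift_tensE_F) (auto simp: eps_elF fusDF_biact)
  qed
  have 2: "lift_tens (\<lambda>h y. lift_tens (\<lambda>f x. ?B f x h y) (tensE_F X (elF b) x)) (tensE_F Y (elF c) y)
      = fusDF X Y x y (b * T c * \<gamma>')"
    if "x \<in> carr X" "y \<in> carr Y" for x y b c
  proof -
    \<comment> \<open>The scalars contributed by an action on \<open>y\<close> cross
      \<open>\<gamma>'\<close> and become \<open>T\<close> of the scalars acting on the leg
      \<open>h\<close>.\<close>
    have *: "e * \<gamma>' * S d * Q (T a) = e * T (Q a) * T (S d) * \<gamma>'" for a d e
    proof -
      have "e * \<gamma>' * S d * Q (T a) = e * \<gamma>' * Q (T a) * S d"
        by (simp add: S_Q mult.assoc)
      then show ?thesis by (simp add: swap[OF gamma_TQ] swap[OF gamma_TS])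
    qed
    have "fusDF X Y x (ract Y (lact Y a y) d) (b * T c * \<gamma>')
        = fusDF X Y x y (b * T (c * Q a * S d) * \<gamma>')"
      if "y \<in> carr Y" for y a c d
      using Y that \<open>x \<in> carr X\<close>
      by (simp add: fusDF_lact fusDF_ract is_bisetD(1,2) T_mult * flip: mult.assoc)
    then show ?thesis
      using that by (subst lift_tensE_F[where X = Y]) (auto simp: 1 eps_elF is_bisetD(1,2)[OF Y])
  qed
  have T_mult': "c * T a * T b = c * T (a * b)" for a b c
    by (simp add: T_mult mult.assoc)
  have 3: "\<beta> (fusCF X Y x y c) = fusDF X Y x y (c * \<gamma>')" if "x \<in> carr X" "y \<in> carr Y" for x y c
    unfolding \<beta>_def fusCF_def using X Y that
    by (subst lift_tens_tensA)
      (auto elim!: carr_Fhat_E simp: tensE_F_in Fhat_acts 2 T_one T_mult')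
  show ?thesis
  proof (rule bij_betw_byWitness[of _ \<beta>])
    show "\<forall>p\<in>carr (Fhat (tensorA (Fhat X) Y)). \<beta> (right_fusion_F X Y p) = p"
      by (auto elim!: carr_fusDF_E[OF X Y] simp: right_fusion_F_fusDF 3 cancel)
    show "\<forall>p\<in>carr (tensorA (Fhat X) (Fhat Y)). right_fusion_F X Y (\<beta> p) = p"
      by (auto elim!: carr_fusCF_E[OF X Y] simp: right_fusion_F_fusDF 3 cancel)
    show "right_fusion_F X Y ` carr (Fhat (tensorA (Fhat X) Y)) \<subseteq> carr (tensorA (Fhat X) (Fhat Y))"
      by (auto elim!: carr_fusDF_E[OF X Y] simp: right_fusion_F_fusDF fusCF_in[OF X Y])
    show "\<beta> ` carr (tensorA (Fhat X) (Fhat Y)) \<subseteq> carr (Fhat (tensorA (Fhat X) Y))"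
      by (auto elim!: carr_fusCF_E[OF X Y] simp: 3 fusDF_in[OF X Y])
  qed
qed

end

section \<open>The fusion morphism of \<open>F\<close> on free bisets\<close>

lemma bij_betw_Fhat_free:
  assumes "free_biset X x"
  shows "bij_betw (\<lambda>c. tensE_F X (elF c) x) UNIV (carr (Fhat X))"
proof -
  have X: "is_biset X" "x \<in> carr X" using assms by (simp_all add: free_biset_def)
  define \<phi> where "\<phi> f z = (case inv (\<lambda>(a, b). ract X (lact X a x) b) z of (a, b) \<Rightarrow> (\<epsilon> * f) * Q a * S b)"
    for z f
  have "inj (\<lambda>(a, b). ract X (lact X a x) b)"
    using assms by (simp add: free_biset_def bij_betw_def)
  from inv_f_f[OF this]
  have \<phi>: "\<phi> (elF c) (ract X (lact X a x) b) = c * Q a * S b" for a b c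
    by (simp add: \<phi>_def eps_elF split: prod.splits)
      (metis (mono_tags, lifting) case_prod_conv old.prod.inject)
  have act: "ract X (lact X a' (ract X (lact X a x) b)) b' = ract X (lact X (a' * a) x) (b * b')"
    for a a' b b'
    using X by (simp add: is_bisetD)
  have \<phi>1: "\<phi> (elF c) x = c" for c
    using \<phi>[of c 1 1] X by (simp add: is_bisetD S_one Q_one)
  show ?thesis
    unfolding tensE_F_def Fhat_def biset.simps
  proof (rule bij_betw_tens[where \<phi> = \<phi>])
    fix f z and s :: "'a \<times> 'a" assume "f \<in> F" "z \<in> carr X"
    moreover obtain a' b' where "s = (a', b')" by (cases s)
    \<comment> \<open>Balance of \<open>\<phi>\<close>: \<open>S\<close> reverses products, so
      \<open>a'\<close> and \<open>b'\<close>, the scalars applied last to \<open>x\<close>, stand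
      next to \<open>c\<close>.\<close>
    moreover have "c * Q (a' * a) * S (b * b') = c * Q a' * S b' * Q a * S b" for a b a' b' c
    proof -
      have "c * Q a' * (S b' * Q a) * S b = c * Q a' * Q a * S b' * S b"
        by (simp add: S_Q[of b' a] mult.assoc)
      then show ?thesis by (simp add: S_mult Q_mult mult.assoc)
    qed
    ultimately show "\<phi> ((\<lambda>f (a1, a2). f * Q a1 * S a2) f s) z =
        \<phi> f ((\<lambda>(a1, a2) x. ract X (lact X a1 x) a2) s z)"
      by (auto elim!: free_bisetE[OF assms] F_E simp: act elF_Q elF_S \<phi>)
  next
    fix f z assume "f \<in> F" "z \<in> carr X"
    then obtain a b c where "z = ract X (lact X a x) b" "f = elF c"
      by (blast elim: free_bisetE[OF assms] F_E)
    then show "\<exists>c\<in>UNIV. tens F (carr X) (\<lambda>f (a1, a2). f * Q a1 * S a2)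
          (\<lambda>(a1, a2) x. ract X (lact X a1 x) a2) f z =
        tens F (carr X) (\<lambda>f (a1, a2). f * Q a1 * S a2)
          (\<lambda>(a1, a2) x. ract X (lact X a1 x) a2) (elF c) x"
      using tensE_F_balance[OF X, unfolded tensE_F_def] by auto
  qed (simp_all add: X elF_in \<phi>1)
qed

text \<open>The left factor of \<open>Y\<close>, a copy of \<open>A \<times> A\<close>, is absorbed
  into \<open>Fhat X\<close>, a copy of \<open>A\<close>, leaving a free biset of rank one.\<close>

lemma free_biset_tensorA_Fhat:
  assumes Xx: "free_biset X x" and Yy: "free_biset Y y"
  shows "free_biset (tensorA (Fhat X) Y) (tensA (Fhat X) Y (tensE_F X (elF 1) x) y)"
proof -
  have X: "is_biset X" "x \<in> carr X" and Y: "is_biset Y" "y \<in> carr Y"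
    using assms by (simp_all add: free_biset_def)
  let ?i = "inv (\<lambda>(a, b). ract Y (lact Y a y) b)" and ?k = "inv (\<lambda>c. tensE_F X (elF c) x)"
  define \<phi> where "\<phi> p z = (?k p * T (fst (?i z)), snd (?i z))" for p z
  have i: "?i (ract Y (lact Y a y) b) = (a, b)" for a b
    using Yy inv_f_f[of "\<lambda>(a, b). ract Y (lact Y a y) b" "(a, b)"]
    by (simp add: free_biset_def bij_betw_def)
  have k: "?k (tensE_F X (elF c) x) = c" for c
    using bij_betw_Fhat_free[OF Xx] inv_f_f[of "\<lambda>c. tensE_F X (elF c) x" c]
    by (simp add: bij_betw_def)
  have \<phi>: "\<phi> (tensE_F X (elF c) x) (ract Y (lact Y a y) b) = (c * T a, b)" for a b c
    by (simp add: \<phi>_def i k)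
  have Fhat_E: "\<exists>c. p = tensE_F X (elF c) x" if "p \<in> carr (Fhat X)" for p
    using that bij_betw_Fhat_free[OF Xx] by (auto simp: bij_betw_def)
  have "bij_betw (\<lambda>w. tensA (Fhat X) Y (tensE_F X (elF (fst w)) x) (ract Y y (snd w))) UNIV
      (carr (tensorA (Fhat X) Y))"
    unfolding tensA_def tensorA_def biset.simps
  proof (rule bij_betw_tens[where \<phi> = \<phi>])
    fix p z s assume "p \<in> carr (Fhat X)" "z \<in> carr Y"
    moreover have "lact Y s (ract Y (lact Y a y) b) = ract Y (lact Y (s * a) y) b" for a b
      using Y by (simp add: is_bisetD)
    ultimately show "\<phi> (ract (Fhat X) p s) z = \<phi> p (lact Y s z)"
      using X by (auto elim!: free_bisetE[OF Yy] dest!: Fhat_E simp: \<phi> Fhat_acts T_mult mult.assoc)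
  next
    fix p z assume "p \<in> carr (Fhat X)" "z \<in> carr Y"
    then obtain a b c where pz: "z = ract Y (lact Y a y) b" "p = tensE_F X (elF c) x"
      by (blast elim: free_bisetE[OF Yy] dest: Fhat_E)
    have "tensA (Fhat X) Y p z = tensA (Fhat X) Y (tensE_F X (elF (c * T a)) x) (ract Y y b)"
      using tensA_balance[OF is_biset_Fhat[OF X(1)] Y(1), of "tensE_F X (elF c) x" "ract Y y b" a] X Y
      unfolding pz by (simp add: is_bisetD(2,7) tensE_F_in Fhat_acts)
    then show "\<exists>w\<in>UNIV. tens (carr (Fhat X)) (carr Y) (ract (Fhat X)) (lact Y) p z =
        tens (carr (Fhat X)) (carr Y) (ract (Fhat X)) (lact Y) (tensE_F X (elF (fst w)) x) (ract Y y (snd w))"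
      unfolding tensA_def by (intro bexI[of _ "(c * T a, b)"]) simp_all
  next
    fix w :: "'a \<times> 'a"
    show "\<phi> (tensE_F X (elF (fst w)) x) (ract Y y (snd w)) = w"
      using \<phi>[of "fst w" 1 "snd w"] Y by (simp add: is_bisetD T_one)
  qed (use X Y in \<open>simp_all add: is_bisetD tensE_F_in\<close>)
  then show ?thesis
    using X Y
    by (simp add: free_biset_def is_biset_tensorA is_biset_Fhat tensA_in tensE_F_in tensorA_acts
        is_bisetD(2) Fhat_acts case_prod_unfold)
qed

lemma bij_betw_fusDF:
  assumes "free_biset X x" "free_biset Y y"
  shows "bij_betw (fusDF X Y x y) UNIV (carr (Fhat (tensorA (Fhat X) Y)))"
  unfolding fusDF_def[abs_def] using assms by (intro bij_betw_Fhat_free free_biset_tensorA_Fhat)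

lemma bij_betw_fusCF:
  assumes Xx: "free_biset X x" and Yy: "free_biset Y y"
  shows "bij_betw (fusCF X Y x y) UNIV (carr (tensorA (Fhat X) (Fhat Y)))"
proof -
  have X: "is_biset X" "x \<in> carr X" and Y: "is_biset Y" "y \<in> carr Y"
    using assms by (simp_all add: free_biset_def)
  let ?i = "inv (\<lambda>c. tensE_F X (elF c) x)" and ?k = "inv (\<lambda>c. tensE_F Y (elF c) y)"
  have i: "?i (tensE_F X (elF c) x) = c" and k: "?k (tensE_F Y (elF c) y) = c" for c
    using bij_betw_Fhat_free[OF Xx] bij_betw_Fhat_free[OF Yy]
      inv_f_f[of "\<lambda>c. tensE_F X (elF c) x" c] inv_f_f[of "\<lambda>c. tensE_F Y (elF c) y" c]
    by (simp_all add: bij_betw_def)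
  have Ex: "\<exists>c. p = tensE_F X (elF c) x" if "p \<in> carr (Fhat X)" for p
    using that bij_betw_Fhat_free[OF Xx] by (auto simp: bij_betw_def)
  have Ey: "\<exists>c. q = tensE_F Y (elF c) y" if "q \<in> carr (Fhat Y)" for q
    using that bij_betw_Fhat_free[OF Yy] by (auto simp: bij_betw_def)
  show ?thesis
    unfolding fusCF_def[abs_def] tensA_def tensorA_def biset.simps
  proof (rule bij_betw_tens[where \<phi> = "\<lambda>p q. ?i p * T (?k q)"])
    fix p q s assume "p \<in> carr (Fhat X)" "q \<in> carr (Fhat Y)"
    then show "?i (ract (Fhat X) p s) * T (?k q) = ?i p * T (?k (lact (Fhat Y) s q))"
      using X Y by (auto dest!: Ex Ey simp: Fhat_acts i k T_mult mult.assoc)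
  next
    fix p q assume "p \<in> carr (Fhat X)" "q \<in> carr (Fhat Y)"
    then obtain b c where "p = tensE_F X (elF b) x" "q = tensE_F Y (elF c) y"
      using Ex Ey by blast
    then show "\<exists>w\<in>UNIV. tens (carr (Fhat X)) (carr (Fhat Y)) (ract (Fhat X)) (lact (Fhat Y)) p q =
        tens (carr (Fhat X)) (carr (Fhat Y)) (ract (Fhat X)) (lact (Fhat Y))
          (tensE_F X (elF w) x) (tensE_F Y (elF 1) y)"
      using fusCF_eq[OF X(1) Y(1) X(2) Y(2)] unfolding fusCF_def tensA_def by blast
  qed (use X Y in \<open>simp_all add: tensE_F_in i k T_one\<close>)
qed

lemma right_Hopf_F_iff:
  fixes \<iota> :: "'a \<Rightarrow> 'u"
  assumes "inj \<iota>"
  shows "right_Hopf_F TYPE('u) \<longleftrightarrow> bij (\<lambda>e. e * \<gamma>)"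
proof
  assume R: "right_Hopf_F TYPE('u)"
  show "bij (\<lambda>e. e * \<gamma>)"
  proof (cases "finite (UNIV :: 'a set)")
    \<comment> \<open>On a free biset in both arguments, fusion is right multiplication by
      \<open>\<gamma>\<close> on \<open>A\<close>.\<close>
    case False
    from free_biset_exists[OF assms this]
    obtain X :: "('a, 'u) biset" and x where X: "free_biset X x" .
    then have X': "is_biset X" "x \<in> carr X" by (simp_all add: free_biset_def)
    have "bij_betw (right_fusion_F X X) (carr (Fhat (tensorA (Fhat X) X))) (carr (tensorA (Fhat X) (Fhat X)))"
      using R X' biset_iso_right_fusion_F_iff[of X X] unfolding right_Hopf_F_def by blast
    then show ?thesis
      using bij_betw_conjugate[OF bij_betw_fusDF[OF X X] bij_betw_fusCF[OF X X],
          of "\<lambda>e. e * \<gamma>" "right_fusion_F X X"]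
      by (simp add: right_fusion_F_fusDF X')
  qed (rule gamma_unit_if_finite)
next
  assume "bij (\<lambda>e. e * \<gamma>)"
  then show "right_Hopf_F TYPE('u)"
    unfolding right_Hopf_F_def bij_mult_right_iff_unit
    by (auto simp: biset_iso_right_fusion_F_iff intro: bij_betw_right_fusion_F)
qed

end

text \<open>The injection makes \<open>'u\<close> a universe at least as large as \<open>A\<close>,
  which provides the free test objects when \<open>A\<close> is infinite.\<close>

theorem lemma5p6:
  fixes T Q :: "'a::monoid_mult \<Rightarrow> 'a" and \<gamma> \<eta> \<epsilon> :: 'a
  assumes "skew_monoidal_monoid T Q \<gamma> \<eta> \<epsilon>"
    and "\<exists>\<iota> :: 'a \<Rightarrow> 'u. inj \<iota>"
  shows
    "(skew_monoidal_monoid.left_Hopf_G T Q \<gamma> \<eta> \<epsilon> TYPE('u) \<longleftrightarrow>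
        bij_betw (skew_monoidal_monoid.can_G T Q \<gamma> \<eta> \<epsilon>)
          (skew_monoidal_monoid.G_tensor_T_G T Q \<gamma> \<epsilon>)
          (carr (tensorA (skew_monoidal_monoid.G_biset T Q \<gamma> \<eta> \<epsilon>)
                         (skew_monoidal_monoid.G_biset T Q \<gamma> \<eta> \<epsilon>)))) \<and>
     (bij_betw (skew_monoidal_monoid.can_G T Q \<gamma> \<eta> \<epsilon>)
          (skew_monoidal_monoid.G_tensor_T_G T Q \<gamma> \<epsilon>)
          (carr (tensorA (skew_monoidal_monoid.G_biset T Q \<gamma> \<eta> \<epsilon>)
                         (skew_monoidal_monoid.G_biset T Q \<gamma> \<eta> \<epsilon>))) \<longleftrightarrow>
        (\<exists>\<gamma>'. \<gamma> * \<gamma>' = 1 \<and> \<gamma>' * \<gamma> = 1)) \<and>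
     ((\<exists>\<gamma>'. \<gamma> * \<gamma>' = 1 \<and> \<gamma>' * \<gamma> = 1) \<longleftrightarrow>
        bij_betw (skew_monoidal_monoid.can_F T Q \<gamma> \<eta> \<epsilon>)
          (skew_monoidal_monoid.F_tensor_Q_F T Q \<gamma> \<eta>)
          (carr (tensorA (skew_monoidal_monoid.F_biset T Q \<gamma> \<eta> \<epsilon>)
                         (skew_monoidal_monoid.F_biset T Q \<gamma> \<eta> \<epsilon>)))) \<and>
     (bij_betw (skew_monoidal_monoid.can_F T Q \<gamma> \<eta> \<epsilon>)
          (skew_monoidal_monoid.F_tensor_Q_F T Q \<gamma> \<eta>)
          (carr (tensorA (skew_monoidal_monoid.F_biset T Q \<gamma> \<eta> \<epsilon>)
                         (skew_monoidal_monoid.F_biset T Q \<gamma> \<eta> \<epsilon>))) \<longleftrightarrow>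
        skew_monoidal_monoid.right_Hopf_F T Q \<gamma> \<eta> \<epsilon> TYPE('u))"
proof -
  interpret skew_monoidal_monoid T Q \<gamma> \<eta> \<epsilon> by (fact assms(1))
  obtain \<iota> :: "'a \<Rightarrow> 'u" where "inj \<iota>" using assms(2) ..
  then show ?thesis
    \<comment> \<open>The conditions on \<open>G\<close> become bijectivity of left, those on
      \<open>F\<close> of right multiplication by \<open>\<gamma>\<close>; either means that
      \<open>\<gamma>\<close> is a unit.\<close>
    unfolding can_G_bij_iff can_F_bij_iff left_Hopf_G_iff[OF \<open>inj \<iota>\<close>] right_Hopf_F_iff[OF \<open>inj \<iota>\<close>]
      bij_mult_left_iff_unit bij_mult_right_iff_unit
    by blast
qed

end
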